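(* Let $T$ be a Tambara functor on $G$ and let $\mathscr{I}_1,\ldots,\mathscr{I}_\ell\subseteq T$ be pairwise coprime ideals. Then: (1) $(\mathscr{I}_1\cdots\mathscr{I}_\ell)(X)=\mathscr{I}_1(X)\cdots\mathscr{I}_\ell(X)$ for every finite $G$-set $X$, where the right hand side is the ordinary product of ideals of the ring $T(X)$. (2) $\mathscr{I}_1\cdots\mathscr{I}_\ell=\mathscr{I}_1\cap\cdots\cap\mathscr{I}_\ell$. (3) The projections $T/(\mathscr{I}_1\cdots\mathscr{I}_\ell)\rightarrow T/\mathscr{I}_i$ $(1\le i\le\ell)$ induce an isomorphism of Tambara functors $$T/(\mathscr{I}_1\cdots\mathscr{I}_\ell)\overset{\cong}{\longrightarrow}T/\mathscr{I}_1\times\cdots\times T/\mathscr{I}_\ell.$$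
   Context: $G$ is a fixed finite group; ${}_G\mathrm{set}$ is the category of finite $G$-sets and $G$-equivariant maps. Rings and monoids are commutative with unit. Semi-Mackey functor $M=(M^*,M_* )$ on $G$: a contravariant functor $M^*$ and a covariant functor $M_*$ from ${}_G\mathrm{set}$ to sets with $M^*(X)=M_*(X)=:M(X)$ such that (a) $M^*$ sends finite coproducts to products; (b) for every pull-back square with $f\colon X\to Y$, $\eta\colon Y'\to Y$, $\xi\colon X'\to X$, $f'\colon X'\to Y'$ one has $M^*(\eta)M_*(f)=M_*(f')M^*(\xi)$. Each $M(X)$ is then a commutative monoid (operation $M_*(\nabla)$, $\nabla\colon X\amalg X\to X$ the folding map). It is a Mackey functor if all $M(X)$ are abelian groups. Exponential diagram of $X\overset{p}{\leftarrow}A$ and $f\colon X\to Y$: up to isomorphism, $\Pi=\{(y,\sigma)\mid y\in Y,\ \sigma\colon f^{-1}(y)\to A \text{ a map of sets},\ p\circ\sigma=\mathrm{id}\}$ with $G$-action by conjugating $\sigma$, $\pi\colon\Pi\to Y$, $\pi(y,\sigma)=y$, $Z=X\times_Y\Pi$, $\rho\colon Z\to\Pi$ the projection, $\lambda\colon Z\to A$, $\lambda(x,(y,\sigma))=\sigma(x)$. Tambara functor $T=(T^*,T_+,T_\bullet)$ on $G$: $T^*$ contravariant, $T_+,T_\bullet$ covariant functors ${}_G\mathrm{set}\to\mathrm{Set}$ such that $(T^*,T_+)$ is a Mackey functor, $(T^*,T_\bullet)$ is a semi-Mackey functor, and $T_\bullet(f)T_+(p)=T_+(\pi)T_\bullet(\rho)T^*(\lambda)$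 for every exponential diagram. Each $T(X)$ is a ring. For $f\colon X\to Y$ write $f^*=T^*(f)$ (a ring homomorphism), $f_+=T_+(f)$ (additive), $f_\bullet=T_\bullet(f)$ (multiplicative). A morphism of Tambara functors is a family of ring homomorphisms $T(X)\to S(X)$ commuting with all $f^*,f_+,f_\bullet$. Products of Tambara functors are taken objectwise. An ideal $\mathscr{I}$ of $T$ is a family of ideals $\mathscr{I}(X)\subseteq T(X)$ such that for every $f\colon X\to Y$: $f^*(\mathscr{I}(Y))\subseteq\mathscr{I}(X)$, $f_+(\mathscr{I}(X))\subseteq\mathscr{I}(Y)$, $f_\bullet(\mathscr{I}(X))\subseteq f_\bullet(0)+\mathscr{I}(Y)$. $T/\mathscr{I}=\{T(X)/\mathscr{I}(X)\}_X$ is a Tambara functor with the induced structure. Intersections and sums of ideals are formed objectwise: $(\mathscr{I}\cap\mathscr{J})(X)=\mathscr{I}(X)\cap\mathscr{J}(X)$, $(\mathscr{I}+\mathscr{J})(X)=\mathscr{I}(X)+\mathscr{J}(X)$; these are ideals of $T$. The product of ideals is the ideal given by $(\mathscr{I}\mathscr{J})(X)=\{p_+(ab)\mid p\colon A\to X \text{ in } {}_G\mathrm{set},\ a\in\mathscr{I}(A),\ b\in\mathscr{J}(A)\}$; this product is associative. Ideals $\mathscr{I},\mathscr{J}$ are coprime if $\mathscr{I}+\mathscr{J}=T$; $\mathscr{I}_1,\dots,\mathscr{I}_\ell$ are pairwise coprime if $\mathscr{I}_i$ and $\mathscr{I}_j$ are coprime for all $1\le i<j\le\ell$. *)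

theory Defs
  imports "HOL-Algebra.Group_Action" "HOL-Algebra.QuotRing" "HOL-Algebra.Ideal_Product" "HOL-Library.FuncSet" "HOL-Library.Infinite_Typeclass"
begin

section \<open>Finite G-sets\<close>

record ('g, 'x) gset =
  pts :: "'x set"
  act :: "'g \<Rightarrow> 'x \<Rightarrow> 'x"

definition finite_gset :: "('g, 'c) monoid_scheme \<Rightarrow> ('g, 'x) gset \<Rightarrow> bool" where
  "finite_gset G X \<longleftrightarrow> finite (pts X) \<and> group_action G (pts X) (act X)"

text \<open>Maps are extensional, so that two elements of a hom-set are equal as soon as they agree
  on the points of the source.\<close>

definition ghom :: "('g, 'c) monoid_scheme \<Rightarrow> ('g, 'x) gset \<Rightarrow> ('g, 'y) gset \<Rightarrow> ('x \<Rightarrow> 'y) set" where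
  "ghom G X Y = {f \<in> pts X \<rightarrow>\<^sub>E pts Y.
     \<forall>g\<in>carrier G. \<forall>x\<in>pts X. f (act X g x) = act Y g (f x)}"

definition gid :: "('g, 'x) gset \<Rightarrow> 'x \<Rightarrow> 'x" where
  "gid X = restrict id (pts X)"

abbreviation gcomp :: "('g, 'x) gset \<Rightarrow> ('y \<Rightarrow> 'z) \<Rightarrow> ('x \<Rightarrow> 'y) \<Rightarrow> 'x \<Rightarrow> 'z" where
  "gcomp X g f \<equiv> compose (pts X) g f"

text \<open>Coproducts, pull-backs and exponential diagrams are only determined up to isomorphism,
  so they are predicates on diagrams, comparing a diagram with the standard construction.
  An equivariant bijection is an isomorphism of G-sets.

  The objects of the category are the finite G-sets whose points lie in a type \<open>'x\<close>. When \<open>'x\<close>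
  is infinite, every finite G-set is isomorphic to one of these, so the category is equivalent
  to that of all finite G-sets and has all the diagrams below.\<close>

definition is_coproduct ::
  "('g, 'c) monoid_scheme \<Rightarrow> nat \<Rightarrow> (nat \<Rightarrow> ('g, 'x) gset) \<Rightarrow> ('g, 'x) gset \<Rightarrow> (nat \<Rightarrow> 'x \<Rightarrow> 'x) \<Rightarrow> bool"
where
  "is_coproduct G n X W i \<longleftrightarrow>
     (\<forall>k<n. finite_gset G (X k) \<and> i k \<in> ghom G (X k) W) \<and> finite_gset G W \<and>
     bij_betw (\<lambda>(k, x). i k x) (SIGMA k:{..<n}. pts (X k)) (pts W)"

text \<open>The square with \<open>f : X \<rightarrow> Y\<close>, \<open>\<eta> : Y' \<rightarrow> Y\<close>, \<open>\<xi> : X' \<rightarrow> X\<close>, \<open>f' : X' \<rightarrow> Y'\<close>.\<close>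

definition is_pullback ::
  "('g, 'c) monoid_scheme \<Rightarrow> ('g, 'x) gset \<Rightarrow> ('g, 'x) gset \<Rightarrow> ('g, 'x) gset \<Rightarrow> ('g, 'x) gset
     \<Rightarrow> ('x \<Rightarrow> 'x) \<Rightarrow> ('x \<Rightarrow> 'x) \<Rightarrow> ('x \<Rightarrow> 'x) \<Rightarrow> ('x \<Rightarrow> 'x) \<Rightarrow> bool"
where
  "is_pullback G X Y X' Y' f \<eta> \<xi> f' \<longleftrightarrow>
     finite_gset G X \<and> finite_gset G Y \<and> finite_gset G X' \<and> finite_gset G Y' \<and>
     f \<in> ghom G X Y \<and> \<eta> \<in> ghom G Y' Y \<and> \<xi> \<in> ghom G X' X \<and> f' \<in> ghom G X' Y' \<and>
     bij_betw (\<lambda>z. (\<xi> z, f' z)) (pts X') {(x, y). x \<in> pts X \<and> y \<in> pts Y' \<and> f x = \<eta> y}"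

text \<open>The G-set of pairs \<open>(y, \<sigma>)\<close> with \<open>\<sigma>\<close> a section of \<open>p\<close> over the fibre \<open>f\<^sup>-\<^sup>1(y)\<close>,
  for \<open>p : A \<rightarrow> X\<close> and \<open>f : X \<rightarrow> Y\<close>.\<close>

definition fibre :: "('g, 'x) gset \<Rightarrow> ('x \<Rightarrow> 'y) \<Rightarrow> 'y \<Rightarrow> 'x set" where
  "fibre X f y = {x \<in> pts X. f x = y}"

definition section_gset ::
  "('g, 'c) monoid_scheme \<Rightarrow> ('g, 'x) gset \<Rightarrow> ('g, 'x) gset \<Rightarrow> ('g, 'x) gset
     \<Rightarrow> ('x \<Rightarrow> 'x) \<Rightarrow> ('x \<Rightarrow> 'x) \<Rightarrow> ('g, 'x \<times> ('x \<Rightarrow> 'x)) gset"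
where
  "section_gset G A X Y p f = (let
       P = {(y, \<sigma>). y \<in> pts Y \<and> \<sigma> \<in> fibre X f y \<rightarrow>\<^sub>E pts A \<and> (\<forall>x\<in>fibre X f y. p (\<sigma> x) = x)}
     in \<lparr> pts = P,
          act = (\<lambda>g. \<lambda>(y, \<sigma>)\<in>P. (act Y g y,
                   \<lambda>x\<in>fibre X f (act Y g y). act A g (\<sigma> (act X (inv\<^bsub>G\<^esub> g) x)))) \<rparr>)"

definition is_exponential ::
  "('g, 'c) monoid_scheme \<Rightarrow> ('g, 'x) gset \<Rightarrow> ('g, 'x) gset \<Rightarrow> ('g, 'x) gset \<Rightarrow> ('g, 'x) gset
     \<Rightarrow> ('g, 'x) gset \<Rightarrow> ('x \<Rightarrow> 'x) \<Rightarrow> ('x \<Rightarrow> 'x) \<Rightarrow> ('x \<Rightarrow> 'x) \<Rightarrow> ('x \<Rightarrow> 'x) \<Rightarrow> ('x \<Rightarrow> 'x) \<Rightarrow> bool"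
where
  "is_exponential G A X Y P Z p f \<pi> \<rho> \<epsilon> \<longleftrightarrow>
     finite_gset G A \<and> p \<in> ghom G A X \<and> \<epsilon> \<in> ghom G Z A \<and>
     (\<exists>e u. e \<in> ghom G P (section_gset G A X Y p f) \<and>
        bij_betw e (pts P) (pts (section_gset G A X Y p f)) \<and>
        (\<forall>w\<in>pts P. \<pi> w = fst (e w)) \<and>
        is_pullback G X Y Z P f \<pi> u \<rho> \<and>
        (\<forall>z\<in>pts Z. \<epsilon> z = snd (e (\<rho> z)) (u z)))"


section \<open>Semi-Mackey and Mackey functors\<close>

text \<open>For \<open>f : X \<rightarrow> Y\<close>, \<open>res M X Y f : M(Y) \<rightarrow> M(X)\<close> is the contravariant and
  \<open>ind M X Y f : M(X) \<rightarrow> M(Y)\<close> the covariant part. Only their values on the sets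
  \<open>obj M _\<close> matter.\<close>

record ('g, 'x, 'm) bifunctor =
  obj :: "('g, 'x) gset \<Rightarrow> 'm set"
  res :: "('g, 'x) gset \<Rightarrow> ('g, 'x) gset \<Rightarrow> ('x \<Rightarrow> 'x) \<Rightarrow> 'm \<Rightarrow> 'm"
  ind :: "('g, 'x) gset \<Rightarrow> ('g, 'x) gset \<Rightarrow> ('x \<Rightarrow> 'x) \<Rightarrow> 'm \<Rightarrow> 'm"

locale semi_mackey_functor = group G for G :: "('g, 'c) monoid_scheme" (structure) +
  fixes M :: "('g, 'x::infinite, 'm) bifunctor"
  assumes finite_group: "finite (carrier G)"
    and res_closed: "\<lbrakk>finite_gset G X; finite_gset G Y; f \<in> ghom G X Y\<rbrakk>
          \<Longrightarrow> res M X Y f \<in> obj M Y \<rightarrow> obj M X"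
    and ind_closed: "\<lbrakk>finite_gset G X; finite_gset G Y; f \<in> ghom G X Y\<rbrakk>
          \<Longrightarrow> ind M X Y f \<in> obj M X \<rightarrow> obj M Y"
    and res_id: "\<lbrakk>finite_gset G X; a \<in> obj M X\<rbrakk> \<Longrightarrow> res M X X (gid X) a = a"
    and ind_id: "\<lbrakk>finite_gset G X; a \<in> obj M X\<rbrakk> \<Longrightarrow> ind M X X (gid X) a = a"
    and res_comp: "\<lbrakk>finite_gset G X; finite_gset G Y; finite_gset G Z;
            f \<in> ghom G X Y; g \<in> ghom G Y Z; a \<in> obj M Z\<rbrakk>
          \<Longrightarrow> res M X Z (gcomp X g f) a = res M X Y f (res M Y Z g a)"
    and ind_comp: "\<lbrakk>finite_gset G X; finite_gset G Y; finite_gset G Z;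
            f \<in> ghom G X Y; g \<in> ghom G Y Z; a \<in> obj M X\<rbrakk>
          \<Longrightarrow> ind M X Z (gcomp X g f) a = ind M Y Z g (ind M X Y f a)"
    and coproduct: "is_coproduct G n U W i
          \<Longrightarrow> bij_betw (\<lambda>a. \<lambda>k\<in>{..<n}. res M (U k) W (i k) a)
                (obj M W) (\<Pi>\<^sub>E k\<in>{..<n}. obj M (U k))"
    and pullback: "\<lbrakk>is_pullback G X Y X' Y' f \<eta> \<xi> f'; a \<in> obj M X\<rbrakk>
          \<Longrightarrow> res M Y' Y \<eta> (ind M X Y f a) = ind M X' Y' f' (res M X' X \<xi> a)"

text \<open>The operation on \<open>M(X)\<close> is \<open>M\<^sub>*(\<nabla>)\<close> transported along \<open>M(X \<amalg> X) \<cong> M(X) \<times> M(X)\<close>,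
  and its unit is the image of the unique element of \<open>M(\<emptyset>)\<close>. The descriptions range over all
  coproducts \<open>W\<close> of two copies of \<open>X\<close> and all empty G-sets \<open>E\<close>; the result does not depend
  on the choice.\<close>

definition bif_op ::
  "('g, 'c) monoid_scheme \<Rightarrow> ('g, 'x, 'm) bifunctor \<Rightarrow> ('g, 'x) gset \<Rightarrow> 'm \<Rightarrow> 'm \<Rightarrow> 'm"
where
  "bif_op G M X a b = (THE r. \<exists>W i fold c.
      is_coproduct G 2 (\<lambda>_. X) W i \<and>
      fold \<in> ghom G W X \<and> gcomp X fold (i 0) = gid X \<and> gcomp X fold (i 1) = gid X \<and>
      c \<in> obj M W \<and> res M X W (i 0) c = a \<and> res M X W (i 1) c = b \<and>
      r = ind M W X fold c)"

definition bif_unit ::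
  "('g, 'c) monoid_scheme \<Rightarrow> ('g, 'x, 'm) bifunctor \<Rightarrow> ('g, 'x) gset \<Rightarrow> 'm"
where
  "bif_unit G M X = (THE r. \<exists>E c. finite_gset G E \<and> pts E = {} \<and> c \<in> obj M E \<and>
      r = ind M E X (\<lambda>_. undefined) c)"

definition bif_monoid ::
  "('g, 'c) monoid_scheme \<Rightarrow> ('g, 'x, 'm) bifunctor \<Rightarrow> ('g, 'x) gset \<Rightarrow> 'm monoid"
where
  "bif_monoid G M X = \<lparr>carrier = obj M X, mult = bif_op G M X, one = bif_unit G M X\<rparr>"

locale mackey_functor = semi_mackey_functor +
  assumes comm_group: "finite_gset G X \<Longrightarrow> comm_group (bif_monoid G M X)"


section \<open>Tambara functors\<close>

text \<open>\<open>tobj T\<close>, \<open>tres T\<close>, \<open>tadd T\<close>, \<open>tmul T\<close> are the common value on objects and the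
  structure maps \<open>f\<^sup>*\<close>, \<open>f\<^sub>+\<close>, \<open>f\<^sub>\<bullet>\<close>.\<close>

record ('g, 'x, 'r) tambara =
  tobj :: "('g, 'x) gset \<Rightarrow> 'r set"
  tres :: "('g, 'x) gset \<Rightarrow> ('g, 'x) gset \<Rightarrow> ('x \<Rightarrow> 'x) \<Rightarrow> 'r \<Rightarrow> 'r"
  tadd :: "('g, 'x) gset \<Rightarrow> ('g, 'x) gset \<Rightarrow> ('x \<Rightarrow> 'x) \<Rightarrow> 'r \<Rightarrow> 'r"
  tmul :: "('g, 'x) gset \<Rightarrow> ('g, 'x) gset \<Rightarrow> ('x \<Rightarrow> 'x) \<Rightarrow> 'r \<Rightarrow> 'r"

definition add_part :: "('g, 'x, 'r) tambara \<Rightarrow> ('g, 'x, 'r) bifunctor" where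
  "add_part T = \<lparr>obj = tobj T, res = tres T, ind = tadd T\<rparr>"

definition mul_part :: "('g, 'x, 'r) tambara \<Rightarrow> ('g, 'x, 'r) bifunctor" where
  "mul_part T = \<lparr>obj = tobj T, res = tres T, ind = tmul T\<rparr>"

locale tambara_functor =
  fixes G :: "('g, 'c) monoid_scheme" (structure) and T :: "('g, 'x::infinite, 'r) tambara"
  assumes mackey: "mackey_functor G (add_part T)"
    and semi_mackey: "semi_mackey_functor G (mul_part T)"
    and exponential: "\<lbrakk>is_exponential G A X Y P Z p f \<pi> \<rho> \<epsilon>; a \<in> tobj T A\<rbrakk>
          \<Longrightarrow> tmul T X Y f (tadd T A X p a) = tadd T P Y \<pi> (tmul T Z P \<rho> (tres T Z A \<epsilon> a))"

definition tring ::
  "('g, 'c) monoid_scheme \<Rightarrow> ('g, 'x, 'r) tambara \<Rightarrow> ('g, 'x) gset \<Rightarrow> 'r ring"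
where
  "tring G T X = \<lparr>carrier = tobj T X,
     mult = bif_op G (mul_part T) X, one = bif_unit G (mul_part T) X,
     zero = bif_unit G (add_part T) X, add = bif_op G (add_part T) X\<rparr>"

definition tambara_hom ::
  "('g, 'c) monoid_scheme \<Rightarrow> ('g, 'x::infinite, 'r) tambara \<Rightarrow> ('g, 'x, 's) tambara
     \<Rightarrow> (('g, 'x) gset \<Rightarrow> 'r \<Rightarrow> 's) \<Rightarrow> bool"
where
  "tambara_hom G T S \<phi> \<longleftrightarrow> tambara_functor G T \<and> tambara_functor G S \<and>
     (\<forall>X. finite_gset G X \<longrightarrow> \<phi> X \<in> ring_hom (tring G T X) (tring G S X)) \<and>
     (\<forall>X Y f. finite_gset G X \<and> finite_gset G Y \<and> f \<in> ghom G X Y \<longrightarrow>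
        (\<forall>b\<in>tobj T Y. \<phi> X (tres T X Y f b) = tres S X Y f (\<phi> Y b)) \<and>
        (\<forall>a\<in>tobj T X. \<phi> Y (tadd T X Y f a) = tadd S X Y f (\<phi> X a)) \<and>
        (\<forall>a\<in>tobj T X. \<phi> Y (tmul T X Y f a) = tmul S X Y f (\<phi> X a)))"

definition tambara_iso ::
  "('g, 'c) monoid_scheme \<Rightarrow> ('g, 'x::infinite, 'r) tambara \<Rightarrow> ('g, 'x, 's) tambara
     \<Rightarrow> (('g, 'x) gset \<Rightarrow> 'r \<Rightarrow> 's) \<Rightarrow> bool"
where
  "tambara_iso G T S \<phi> \<longleftrightarrow> tambara_hom G T S \<phi> \<and>
     (\<exists>\<psi>. tambara_hom G S T \<psi> \<and>
        (\<forall>X. finite_gset G X \<longrightarrow>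
          (\<forall>a\<in>tobj T X. \<psi> X (\<phi> X a) = a) \<and> (\<forall>b\<in>tobj S X. \<phi> X (\<psi> X b) = b)))"

definition tambara_prod ::
  "'i set \<Rightarrow> ('i \<Rightarrow> ('g, 'x, 'r) tambara) \<Rightarrow> ('g, 'x, 'i \<Rightarrow> 'r) tambara"
where
  "tambara_prod J S = \<lparr>
     tobj = (\<lambda>X. \<Pi>\<^sub>E i\<in>J. tobj (S i) X),
     tres = (\<lambda>X Y f b. \<lambda>i\<in>J. tres (S i) X Y f (b i)),
     tadd = (\<lambda>X Y f a. \<lambda>i\<in>J. tadd (S i) X Y f (a i)),
     tmul = (\<lambda>X Y f a. \<lambda>i\<in>J. tmul (S i) X Y f (a i))\<rparr>"


section \<open>Ideals\<close>

definition tambara_ideal ::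
  "('g, 'c) monoid_scheme \<Rightarrow> ('g, 'x, 'r) tambara \<Rightarrow> (('g, 'x) gset \<Rightarrow> 'r set) \<Rightarrow> bool"
where
  "tambara_ideal G T I \<longleftrightarrow>
     (\<forall>X. finite_gset G X \<longrightarrow> ideal (I X) (tring G T X)) \<and>
     (\<forall>X Y f. finite_gset G X \<and> finite_gset G Y \<and> f \<in> ghom G X Y \<longrightarrow>
        tres T X Y f ` I Y \<subseteq> I X \<and>
        tadd T X Y f ` I X \<subseteq> I Y \<and>
        tmul T X Y f ` I X \<subseteq> tmul T X Y f \<zero>\<^bsub>tring G T X\<^esub> <+\<^bsub>tring G T Y\<^esub> I Y)"

definition ideal_sum ::
  "('g, 'c) monoid_scheme \<Rightarrow> ('g, 'x, 'r) tambara \<Rightarrow> (('g, 'x) gset \<Rightarrow> 'r set)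
     \<Rightarrow> (('g, 'x) gset \<Rightarrow> 'r set) \<Rightarrow> ('g, 'x) gset \<Rightarrow> 'r set"
where
  "ideal_sum G T I J X = I X <+>\<^bsub>tring G T X\<^esub> J X"

definition coprime_ideals ::
  "('g, 'c) monoid_scheme \<Rightarrow> ('g, 'x, 'r) tambara \<Rightarrow> (('g, 'x) gset \<Rightarrow> 'r set)
     \<Rightarrow> (('g, 'x) gset \<Rightarrow> 'r set) \<Rightarrow> bool"
where
  "coprime_ideals G T I J \<longleftrightarrow> (\<forall>X. finite_gset G X \<longrightarrow> ideal_sum G T I J X = tobj T X)"

definition tambara_ideal_prod ::
  "('g, 'c) monoid_scheme \<Rightarrow> ('g, 'x, 'r) tambara \<Rightarrow> (('g, 'x) gset \<Rightarrow> 'r set)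
     \<Rightarrow> (('g, 'x) gset \<Rightarrow> 'r set) \<Rightarrow> ('g, 'x) gset \<Rightarrow> 'r set"
where
  "tambara_ideal_prod G T I J X =
     {tadd T A X p (a \<otimes>\<^bsub>tring G T A\<^esub> b) | A p a b.
        finite_gset G A \<and> p \<in> ghom G A X \<and> a \<in> I A \<and> b \<in> J A}"

text \<open>\<open>(\<dots>((I\<^sub>1 \<cdot> I\<^sub>2) \<cdot> I\<^sub>3)\<dots>) \<cdot> I\<^sub>l\<close> for \<open>l \<ge> 1\<close>.\<close>

definition iterated_prod :: "('a \<Rightarrow> 'a \<Rightarrow> 'a) \<Rightarrow> (nat \<Rightarrow> 'a) \<Rightarrow> nat \<Rightarrow> 'a" where
  "iterated_prod op I l = foldl op (I 1) (map I [2..<Suc l])"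

text \<open>The elements of \<open>(T/I)(X)\<close> are the cosets of \<open>I(X)\<close>. When the coset of the image does not
  depend on the representative \<open>a \<in> C\<close>, the unions below are that coset.\<close>

definition tambara_quot ::
  "('g, 'c) monoid_scheme \<Rightarrow> ('g, 'x, 'r) tambara \<Rightarrow> (('g, 'x) gset \<Rightarrow> 'r set)
     \<Rightarrow> ('g, 'x, 'r set) tambara"
where
  "tambara_quot G T I = \<lparr>
     tobj = (\<lambda>X. carrier (tring G T X Quot I X)),
     tres = (\<lambda>X Y f C. \<Union>b\<in>C. I X +>\<^bsub>tring G T X\<^esub> tres T X Y f b),
     tadd = (\<lambda>X Y f C. \<Union>a\<in>C. I Y +>\<^bsub>tring G T Y\<^esub> tadd T X Y f a),
     tmul = (\<lambda>X Y f C. \<Union>a\<in>C. I Y +>\<^bsub>tring G T Y\<^esub> tmul T X Y f a)\<rparr>"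

text \<open>For \<open>J \<subseteq> I\<close>, the projection \<open>T/J \<rightarrow> T/I\<close>, sending the coset of \<open>a\<close> to the coset of \<open>a\<close>.\<close>

definition quot_proj ::
  "('g, 'c) monoid_scheme \<Rightarrow> ('g, 'x, 'r) tambara \<Rightarrow> (('g, 'x) gset \<Rightarrow> 'r set)
     \<Rightarrow> ('g, 'x) gset \<Rightarrow> 'r set \<Rightarrow> 'r set"
where
  "quot_proj G T I X C = (\<Union>a\<in>C. I X +>\<^bsub>tring G T X\<^esub> a)"

end

theory Submission
  imports Defs
begin

text \<open>
  Everything rests on the coproduct \<open>X \<amalg> X\<close> with its folding map \<open>\<nabla>\<close>. If \<open>1 = e + f\<close> with
  \<open>e \<in> I(X)\<close>, \<open>f \<in> J(X)\<close> and \<open>x \<in> I(X) \<inter> J(X)\<close>, then \<open>x = ex + xf = \<nabla>\<^sub>+((e, x) \<cdot> (x, f))\<close> with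
  \<open>(e, x) \<in> I(X \<amalg> X)\<close> and \<open>(x, f) \<in> J(X \<amalg> X)\<close>, so the product of coprime ideals is their
  intersection; the rest of (1) and (2) is ring theory at each \<open>X\<close>.

  For (3), \<open>f\<^sub>\<bullet>\<close> descends to \<open>T/I\<close> because the exponential diagram of \<open>\<nabla>\<close> and \<open>f\<close> gives
  \<open>f\<^sub>\<bullet>(d + a) = \<pi>\<^sub>+(\<nu>(d) \<cdot> N)\<close>, where \<open>N\<close> depends only on \<open>a\<close> and \<open>\<nu>(d) - \<nu>(0)\<close> lies in the ideal when
  \<open>d\<close> does. A family that is the image of a Tambara functor under a surjection respecting the
  structure maps satisfies all the axioms except perhaps the injectivity of
  \<open>M(U \<amalg> V) \<rightarrow> M(U) \<times> M(V)\<close>; this applies to \<open>T/I\<close> and, by the Chinese remainder theorem, to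
  the product of the \<open>T/I\<^sub>i\<close>.
\<close>

section \<open>Constructions with finite G-sets\<close>

text \<open>The ring operations of \<open>tring\<close> are definite descriptions over all
  coproducts and all empty G-sets. They become usable once base change shows that any single folding
  map computes them; the same base change shows that restriction and induction respect them. The
  ideal axiom controls \<open>f\<^sub>\<bullet>\<close> only near 0, whereas descent to
  \<open>T/I\<close> asks for control near every \<open>a\<close>, and
  \<open>f\<^sub>\<bullet>\<close> is not additive. The exponential diagram bridges this gap: it is
  the expansion of a product of binomials, writing the norm of a sum as a sum over all ways of
  choosing one summand at each point of a fibre. The injectivity that images may lose holds for
  \<open>T/I\<close> because an element of \<open>T(W)\<close> is the sum over the summands of
  \<open>W\<close> of its restrictions, each induced back to \<open>W\<close>; if all restrictions
  lie in the ideal, so does the element. A product of coprime ideals is recognised as an ideal by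
  being identified with the intersection.\<close>

lemma finite_gset_group: "finite_gset G X \<Longrightarrow> group G"
  by (auto simp: finite_gset_def group_action_def group_hom_def)

lemma act_closed:
  assumes "finite_gset G X" "g \<in> carrier G" "x \<in> pts X"
  shows "act X g x \<in> pts X"
proof -
  interpret group_action G "pts X" "act X" using assms by (simp add: finite_gset_def)
  show ?thesis using element_image assms by blast
qed

lemma act_one:
  assumes "finite_gset G X" "x \<in> pts X"
  shows "act X \<one>\<^bsub>G\<^esub> x = x"
proof -
  interpret group_action G "pts X" "act X" using assms by (simp add: finite_gset_def)
  show ?thesis using id_eq_one assms by (metis restrict_apply')
qed

lemma act_mult:
  assumes "finite_gset G X" "g \<in> carrier G" "h \<in> carrier G" "x \<in> pts X"
  shows "act X (g \<otimes>\<^bsub>G\<^esub> h) x = act X g (act X h x)"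
proof -
  interpret group_action G "pts X" "act X" using assms by (simp add: finite_gset_def)
  show ?thesis using composition_rule assms by blast
qed

lemma act_inv_cancel:
  assumes "finite_gset G X" "g \<in> carrier G" "x \<in> pts X"
  shows "act X (inv\<^bsub>G\<^esub> g) (act X g x) = x" "act X g (act X (inv\<^bsub>G\<^esub> g) x) = x"
proof -
  interpret group G using assms finite_gset_group by blast
  show "act X (inv\<^bsub>G\<^esub> g) (act X g x) = x" "act X g (act X (inv\<^bsub>G\<^esub> g) x) = x"
    using assms by (metis act_mult act_one inv_closed l_inv, metis act_mult act_one inv_closed r_inv)
qed

lemma finite_gset_finite: "finite_gset G X \<Longrightarrow> finite (pts X)"
  by (simp add: finite_gset_def)

text \<open>\<open>group_action\<close> means a homomorphism into \<open>BijGroup\<close>, whose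
  elements are extensional functions; this is why \<open>closed\<close> asks for
  \<open>\<rightarrow>\<^sub>E\<close>. Bijectivity comes from the action of the inverse
  element.\<close>

lemma finite_gsetI:
  assumes "group G" and "finite (pts X)"
    and closed: "\<And>g. g \<in> carrier G \<Longrightarrow> act X g \<in> pts X \<rightarrow>\<^sub>E pts X"
    and one: "\<And>x. x \<in> pts X \<Longrightarrow> act X \<one>\<^bsub>G\<^esub> x = x"
    and mult: "\<And>g h x. \<lbrakk>g \<in> carrier G; h \<in> carrier G; x \<in> pts X\<rbrakk>
      \<Longrightarrow> act X (g \<otimes>\<^bsub>G\<^esub> h) x = act X g (act X h x)"
  shows "finite_gset G X"
proof -
  interpret group G by fact
  have inv: "act X (inv\<^bsub>G\<^esub> g) (act X g x) = x" "act X g (act X (inv\<^bsub>G\<^esub> g) x) = x"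
    if "g \<in> carrier G" "x \<in> pts X" for g x
    using that by (metis mult one inv_closed l_inv, metis mult one inv_closed r_inv)
  have Bij: "act X g \<in> Bij (pts X)" if "g \<in> carrier G" for g
    using that closed[OF that] closed[OF inv_closed[OF that]] inv[OF that] unfolding Bij_def
    by (auto intro!: bij_betw_byWitness[where f' = "act X (inv\<^bsub>G\<^esub> g)"] simp: PiE_def)
  have "act X \<in> hom G (BijGroup (pts X))"
    using Bij closed mult
    by (intro homI) (auto simp: BijGroup_def PiE_def extensional_def compose_def fun_eq_iff)
  thus ?thesis
    using assms group_BijGroup
    by (auto simp: finite_gset_def group_action_def group_hom_def group_hom_axioms_def)
qed

lemma ghom_closed: "f \<in> ghom G X Y \<Longrightarrow> x \<in> pts X \<Longrightarrow> f x \<in> pts Y"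
  by (auto simp: ghom_def)

lemma ghom_act:
  "f \<in> ghom G X Y \<Longrightarrow> g \<in> carrier G \<Longrightarrow> x \<in> pts X \<Longrightarrow> f (act X g x) = act Y g (f x)"
  by (auto simp: ghom_def)

lemma ghom_extensional: "f \<in> ghom G X Y \<Longrightarrow> f \<in> extensional (pts X)"
  by (auto simp: ghom_def PiE_def)

lemma ghom_eqI:
  "\<lbrakk>f \<in> ghom G X Y; f' \<in> ghom G X Y'; \<And>x. x \<in> pts X \<Longrightarrow> f x = f' x\<rbrakk> \<Longrightarrow> f = f'"
  by (meson extensionalityI ghom_extensional)

lemma ghomI:
  assumes "f \<in> extensional (pts X)" "\<And>x. x \<in> pts X \<Longrightarrow> f x \<in> pts Y"
    and "\<And>g x. g \<in> carrier G \<Longrightarrow> x \<in> pts X \<Longrightarrow> f (act X g x) = act Y g (f x)"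
  shows "f \<in> ghom G X Y"
  using assms by (auto simp: ghom_def PiE_def)

lemma ghom_restrictI:
  assumes "finite_gset G X" "\<And>x. x \<in> pts X \<Longrightarrow> f x \<in> pts Y"
    and "\<And>g x. g \<in> carrier G \<Longrightarrow> x \<in> pts X \<Longrightarrow> f (act X g x) = act Y g (f x)"
  shows "restrict f (pts X) \<in> ghom G X Y"
  using assms act_closed by (intro ghomI) fastforce+

lemma gid_ghom: "finite_gset G X \<Longrightarrow> gid X \<in> ghom G X X"
  unfolding gid_def by (rule ghom_restrictI) auto

lemma gcomp_ghom:
  assumes "finite_gset G X" "f \<in> ghom G X Y" "g \<in> ghom G Y Z"
  shows "gcomp X g f \<in> ghom G X Z"
  unfolding compose_def using assms
  by (intro ghom_restrictI) (auto simp: ghom_closed ghom_act)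

text \<open>Maps being extensional, the unique map out of an empty G-set is literally this constant
  function, the form in which \<open>bif_unit\<close> uses it.\<close>

lemma ghom_empty: "pts E = {} \<Longrightarrow> (\<lambda>_. undefined) \<in> ghom G E X"
  by (rule ghomI) (auto simp: extensional_def)

lemma finite_gset_empty: "group G \<Longrightarrow> finite_gset G \<lparr>pts = {}, act = \<lambda>_ _. undefined\<rparr>"
  by (rule finite_gsetI) (auto simp: PiE_def extensional_def)

text \<open>The standard constructions live in types of pairs or of sections, while functors only
  see G-sets over \<open>'x\<close>. Since \<open>'x\<close> is infinite it has a subset of the
  right cardinality, to which the action is carried over.\<close>

lemma gset_transport:
  assumes S: "finite_gset G (S :: ('g, 'y) gset)"
  obtains X :: "('g, 'x::infinite) gset" and e
  where "finite_gset G X" "e \<in> ghom G X S" "bij_betw e (pts X) (pts S)"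
proof -
  interpret group G using S finite_gset_group by blast
  obtain B :: "'x set" where B: "finite B" "card B = card (pts S)"
    using infinite_arbitrarily_large[OF infinite_UNIV] by metis
  then obtain e0 where e0: "bij_betw e0 B (pts S)"
    using finite_same_card_bij[OF B(1) finite_gset_finite[OF S]] by blast
  define e where "e = restrict e0 B"
  have e: "bij_betw e B (pts S)" using e0 by (simp add: e_def)
  define i where "i = inv_into B e"
  have ie: "i (e x) = x" if "x \<in> B" for x
    using that e by (simp add: i_def bij_betw_def)
  have ei: "e (i y) = y" "i y \<in> B" if "y \<in> pts S" for y
    using that e by (auto simp: i_def bij_betw_def f_inv_into_f inv_into_into)
  have eS: "e x \<in> pts S" if "x \<in> B" for x
    using that e by (auto simp: bij_betw_def)
  let ?X = "\<lparr>pts = B, act = (\<lambda>g. \<lambda>x\<in>B. i (act S g (e x)))\<rparr>"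
  have "finite_gset G ?X"
    using B by (intro finite_gsetI) (auto simp: ie ei eS act_closed[OF S] act_one[OF S] act_mult[OF S])
  moreover have "e \<in> ghom G ?X S"
    by (rule ghomI) (auto simp: e_def[symmetric] ie ei eS act_closed[OF S] intro: restrict_extensional,
        simp add: e_def)
  ultimately show thesis using that e by simp
qed

section \<open>Coproducts of finite G-sets\<close>

lemma is_coproductD:
  assumes "is_coproduct G n U W i"
  shows "finite_gset G W" "k < n \<Longrightarrow> finite_gset G (U k)" "k < n \<Longrightarrow> i k \<in> ghom G (U k) W"
  using assms by (auto simp: is_coproduct_def)

lemma coproduct_cases:
  assumes "is_coproduct G n U W i" "w \<in> pts W"
  obtains k x where "k < n" "x \<in> pts (U k)" "w = i k x"
proof -
  have "w \<in> (\<lambda>(k, x). i k x) ` (SIGMA k:{..<n}. pts (U k))"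
    using assms by (simp add: is_coproduct_def bij_betw_def)
  thus thesis using that by auto
qed

lemma coproduct_inj:
  assumes "is_coproduct G n U W i" "k < n" "x \<in> pts (U k)" "k' < n" "x' \<in> pts (U k')" "i k x = i k' x'"
  shows "k = k'" "x = x'"
proof -
  have "inj_on (\<lambda>(k, x). i k x) (SIGMA k:{..<n}. pts (U k))"
    using assms by (simp add: is_coproduct_def bij_betw_def)
  from inj_onD[OF this, of "(k, x)" "(k', x')"] show "k = k'" "x = x'" using assms by auto
qed

lemma is_coproductI:
  assumes "finite_gset G W" "\<And>k. k < n \<Longrightarrow> finite_gset G (U k)" "\<And>k. k < n \<Longrightarrow> i k \<in> ghom G (U k) W"
    and "\<And>w. w \<in> pts W \<Longrightarrow> \<exists>k x. k < n \<and> x \<in> pts (U k) \<and> w = i k x"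
    and "\<And>k x k' x'. \<lbrakk>k < n; x \<in> pts (U k); k' < n; x' \<in> pts (U k'); i k x = i k' x'\<rbrakk>
      \<Longrightarrow> k = k' \<and> x = x'"
  shows "is_coproduct G n U W i"
proof -
  have "(\<lambda>(k, x). i k x) ` (SIGMA k:{..<n}. pts (U k)) = pts W"
    using assms(3,4) ghom_closed by (force simp: image_iff)
  moreover have "inj_on (\<lambda>(k, x). i k x) (SIGMA k:{..<n}. pts (U k))"
  proof (rule inj_onI; clarsimp)
    fix k x k' x' assume "k < n" "x \<in> pts (U k)" "k' < n" "x' \<in> pts (U k')" "i k x = i k' x'"
    thus "k = k' \<and> x = x'" by (rule assms(5))
  qed
  ultimately show ?thesis using assms(1-3) by (auto simp: is_coproduct_def bij_betw_def)
qed

lemma coproduct_exists: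
  fixes X :: "('g, 'x::infinite) gset"
  assumes X: "finite_gset G X"
  obtains W i where "is_coproduct G n (\<lambda>_. X) W i"
proof -
  interpret group G using X finite_gset_group by blast
  let ?S = "\<lparr>pts = {..<n} \<times> pts X, act = (\<lambda>g. \<lambda>(k, x)\<in>{..<n} \<times> pts X. (k, act X g x))\<rparr>"
  have S: "finite_gset G ?S"
    using finite_gset_finite[OF X]
    by (intro finite_gsetI) (auto simp: act_closed[OF X] act_one[OF X] act_mult[OF X])
  obtain W :: "('g, 'x) gset" and e where W: "finite_gset G W" "e \<in> ghom G W ?S" "bij_betw e (pts W) (pts ?S)"
    using gset_transport[OF S] by blast
  define i where "i = (\<lambda>k. \<lambda>x\<in>pts X. inv_into (pts W) e (k, x))"
  have ei: "e (i k x) = (k, x)" "i k x \<in> pts W" if "k < n" "x \<in> pts X" for k x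
    using that W(3) by (auto simp: i_def bij_betw_def f_inv_into_f inv_into_into)
  have ie: "inv_into (pts W) e (e w) = w" if "w \<in> pts W" for w
    using that W(3) by (simp add: bij_betw_def)
  have act: "i k (act X g x) = act W g (i k x)" if "k < n" "g \<in> carrier G" "x \<in> pts X" for k g x
  proof -
    have "e (act W g (i k x)) = (k, act X g x)"
      using that ei ghom_act[OF W(2)] by simp
    thus ?thesis using that ie[of "act W g (i k x)"] ei act_closed[OF W(1)] act_closed[OF X]
      by (metis (no_types, lifting) i_def restrict_apply')
  qed
  have "is_coproduct G n (\<lambda>_. X) W i"
  proof (rule is_coproductI)
    fix w assume w: "w \<in> pts W"
    obtain k x where kx: "e w = (k, x)" by force
    hence "k < n" "x \<in> pts X" using ghom_closed[OF W(2) w] by auto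
    moreover have "w = i k x" using ie[OF w] kx \<open>x \<in> pts X\<close> by (simp add: i_def)
    ultimately show "\<exists>k x. k < n \<and> x \<in> pts X \<and> w = i k x" by blast
  next
    fix k assume "k < n"
    thus "i k \<in> ghom G X W"
      by (intro ghomI) (auto simp: ei act, simp add: i_def)
  next
    fix k x k' x' assume "k < n" "x \<in> pts X" "k' < n" "x' \<in> pts X" "i k x = i k' x'"
    thus "k = k' \<and> x = x'" using ei by (metis Pair_inject)
  qed (use X W in auto)
  thus thesis using that by blast
qed

text \<open>The existence half of the universal property; uniqueness is checked pointwise with
  \<open>coproduct_cases\<close> where it is wanted.\<close>

lemma coproduct_desc:
  assumes W: "is_coproduct G n U W i" and h: "\<And>k. k < n \<Longrightarrow> h k \<in> ghom G (U k) Y"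
  obtains m where "m \<in> ghom G W Y" "\<And>k x. k < n \<Longrightarrow> x \<in> pts (U k) \<Longrightarrow> m (i k x) = h k x"
proof -
  note D = is_coproductD[OF W]
  define m where "m = (\<lambda>w\<in>pts W. case inv_into (SIGMA k:{..<n}. pts (U k)) (\<lambda>(k, x). i k x) w of (k, x) \<Rightarrow> h k x)"
  have m: "m (i k x) = h k x" if "k < n" "x \<in> pts (U k)" for k x
  proof -
    have "inv_into (SIGMA k:{..<n}. pts (U k)) (\<lambda>(k, x). i k x) (i k x) = (k, x)"
      using W that inv_into_f_f[of "\<lambda>(k, x). i k x" "SIGMA k:{..<n}. pts (U k)" "(k, x)"]
      by (simp add: is_coproduct_def bij_betw_def)
    thus ?thesis using that ghom_closed[OF D(3)] by (simp add: m_def)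
  qed
  have "m \<in> ghom G W Y"
  proof (rule ghomI)
    fix w assume "w \<in> pts W"
    then obtain k x where kx: "k < n" "x \<in> pts (U k)" "w = i k x" by (rule coproduct_cases[OF W])
    show "m w \<in> pts Y" using kx m ghom_closed[OF h] by simp
    fix g assume g: "g \<in> carrier G"
    have "act W g w = i k (act (U k) g x)" using kx g ghom_act[OF D(3)] by simp
    thus "m (act W g w) = act Y g (m w)"
      using kx m g act_closed[OF D(2)] ghom_act[OF h] by simp
  qed (simp add: m_def)
  thus thesis using that m by blast
qed

section \<open>Pull-back squares and their interplay with coproducts\<close>

lemma is_pullbackI:
  assumes "finite_gset G X" "finite_gset G Y" "finite_gset G X'" "finite_gset G Y'"
    "f \<in> ghom G X Y" "\<eta> \<in> ghom G Y' Y" "\<xi> \<in> ghom G X' X" "f' \<in> ghom G X' Y'"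
    and "\<And>z. z \<in> pts X' \<Longrightarrow> f (\<xi> z) = \<eta> (f' z)"
    and "\<And>x y. \<lbrakk>x \<in> pts X; y \<in> pts Y'; f x = \<eta> y\<rbrakk> \<Longrightarrow> \<exists>z\<in>pts X'. \<xi> z = x \<and> f' z = y"
    and "\<And>z z'. \<lbrakk>z \<in> pts X'; z' \<in> pts X'; \<xi> z = \<xi> z'; f' z = f' z'\<rbrakk> \<Longrightarrow> z = z'"
  shows "is_pullback G X Y X' Y' f \<eta> \<xi> f'"
proof -
  have "(\<lambda>z. (\<xi> z, f' z)) ` pts X' = {(x, y). x \<in> pts X \<and> y \<in> pts Y' \<and> f x = \<eta> y}"
    using assms(7-10) ghom_closed by (fastforce simp: image_iff)
  moreover have "inj_on (\<lambda>z. (\<xi> z, f' z)) (pts X')"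
    using assms(11) by (auto intro: inj_onI)
  ultimately show ?thesis using assms(1-8) by (simp add: is_pullback_def bij_betw_def)
qed

lemma is_pullbackD:
  assumes "is_pullback G X Y X' Y' f \<eta> \<xi> f'"
  shows "finite_gset G X" "finite_gset G Y" "finite_gset G X'" "finite_gset G Y'"
    "f \<in> ghom G X Y" "\<eta> \<in> ghom G Y' Y" "\<xi> \<in> ghom G X' X" "f' \<in> ghom G X' Y'"
    and "z \<in> pts X' \<Longrightarrow> f (\<xi> z) = \<eta> (f' z)"
    and "\<lbrakk>x \<in> pts X; y \<in> pts Y'; f x = \<eta> y\<rbrakk> \<Longrightarrow> \<exists>z\<in>pts X'. \<xi> z = x \<and> f' z = y"
    and "\<lbrakk>z \<in> pts X'; z' \<in> pts X'; \<xi> z = \<xi> z'; f' z = f' z'\<rbrakk> \<Longrightarrow> z = z'"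
proof -
  have b: "inj_on (\<lambda>z. (\<xi> z, f' z)) (pts X')"
    "(\<lambda>z. (\<xi> z, f' z)) ` pts X' = {(x, y). x \<in> pts X \<and> y \<in> pts Y' \<and> f x = \<eta> y}"
    using assms by (auto simp: is_pullback_def bij_betw_def)
  show "z \<in> pts X' \<Longrightarrow> f (\<xi> z) = \<eta> (f' z)" using b(2) by auto
  show "\<exists>z\<in>pts X'. \<xi> z = x \<and> f' z = y" if "x \<in> pts X" "y \<in> pts Y'" "f x = \<eta> y"
  proof -
    have "(x, y) \<in> (\<lambda>z. (\<xi> z, f' z)) ` pts X'" using that by (simp add: b(2))
    thus ?thesis by auto
  qed
  show "\<lbrakk>z \<in> pts X'; z' \<in> pts X'; \<xi> z = \<xi> z'; f' z = f' z'\<rbrakk> \<Longrightarrow> z = z'"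
    using inj_onD[OF b(1), of z z'] by simp
qed (use assms in \<open>simp_all add: is_pullback_def\<close>)

lemma pullback_exists:
  fixes X :: "('g, 'x::infinite) gset"
  assumes X: "finite_gset G X" and Y: "finite_gset G Y" and Y': "finite_gset G Y'"
    and f: "f \<in> ghom G X Y" and \<eta>: "\<eta> \<in> ghom G Y' Y"
  obtains X' \<xi> f' where "is_pullback G X Y X' Y' f \<eta> \<xi> f'"
proof -
  interpret group G using X finite_gset_group by blast
  define Q where "Q = {(x, y). x \<in> pts X \<and> y \<in> pts Y' \<and> f x = \<eta> y}"
  let ?S = "\<lparr>pts = Q, act = (\<lambda>g. \<lambda>(x, y)\<in>Q. (act X g x, act Y' g y))\<rparr>"
  have "finite Q"
    by (rule finite_subset[of _ "pts X \<times> pts Y'"])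
      (use finite_gset_finite[OF X] finite_gset_finite[OF Y'] in \<open>auto simp: Q_def\<close>)
  hence S: "finite_gset G ?S"
    by (intro finite_gsetI)
      (auto simp: Q_def act_closed[OF X] act_one[OF X] act_mult[OF X] act_closed[OF Y']
        act_one[OF Y'] act_mult[OF Y'] ghom_act[OF f] ghom_act[OF \<eta>])
  obtain Z :: "('g, 'x) gset" and e where Z: "finite_gset G Z" "e \<in> ghom G Z ?S" "bij_betw e (pts Z) (pts ?S)"
    using gset_transport[OF S] by blast
  have eQ: "e z \<in> Q" if "z \<in> pts Z" for z using ghom_closed[OF Z(2) that] by simp
  have eact: "e (act Z g z) = (act X g (fst (e z)), act Y' g (snd (e z)))" if "g \<in> carrier G" "z \<in> pts Z" for g z
    using ghom_act[OF Z(2) that] eQ[OF that(2)] by (auto split: prod.splits)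
  let ?\<xi> = "restrict (\<lambda>z. fst (e z)) (pts Z)" and ?f' = "restrict (\<lambda>z. snd (e z)) (pts Z)"
  have "is_pullback G X Y Z Y' f \<eta> ?\<xi> ?f'"
  proof (rule is_pullbackI)
    show "?\<xi> \<in> ghom G Z X" "?f' \<in> ghom G Z Y'"
      using eQ by (fastforce intro!: ghom_restrictI Z simp: eact Q_def split: prod.splits)+
    fix x y assume "x \<in> pts X" "y \<in> pts Y'" "f x = \<eta> y"
    hence "(x, y) \<in> e ` pts Z" using Z(3) by (simp add: bij_betw_def Q_def)
    then obtain z where "z \<in> pts Z" "(x, y) = e z" by blast
    thus "\<exists>z\<in>pts Z. ?\<xi> z = x \<and> ?f' z = y" by (intro bexI[of _ z]) (metis fst_conv snd_conv restrict_apply', simp)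
  next
    fix z z' assume "z \<in> pts Z" "z' \<in> pts Z" "?\<xi> z = ?\<xi> z'" "?f' z = ?f' z'"
    thus "z = z'" using Z(3) by (simp add: bij_betw_def inj_on_def prod_eq_iff)
  next
    fix z assume "z \<in> pts Z"
    thus "f (?\<xi> z) = \<eta> (?f' z)" using eQ[of z] by (auto simp: Q_def)
  qed (use assms Z in auto)
  thus thesis using that by blast
qed

text \<open>Summands are disjoint, so a point of \<open>W\<close> sent into the \<open>k\<close>-th
  summand of \<open>W'\<close> already lies in the \<open>k\<close>-th summand of \<open>W\<close>.
  This lets the component of an element induced along \<open>h\<close> be computed from the map
  \<open>f k\<close> alone.\<close>

lemma coproduct_map_pullback:
  assumes W: "is_coproduct G n U W i" and W': "is_coproduct G n V W' i'"
    and h: "h \<in> ghom G W W'" and f: "\<And>k. k < n \<Longrightarrow> f k \<in> ghom G (U k) (V k)"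
    and hi: "\<And>k x. k < n \<Longrightarrow> x \<in> pts (U k) \<Longrightarrow> h (i k x) = i' k (f k x)"
    and k: "k < n"
  shows "is_pullback G W W' (U k) (V k) h (i' k) (i k) (f k)"
proof (rule is_pullbackI)
  fix w y assume w: "w \<in> pts W" and y: "y \<in> pts (V k)" and eq: "h w = i' k y"
  obtain j x where j: "j < n" "x \<in> pts (U j)" "w = i j x" using coproduct_cases[OF W w] .
  have "j = k" "f j x = y"
    using coproduct_inj[OF W' j(1) ghom_closed[OF f[OF j(1)] j(2)] k y] eq hi j by auto
  thus "\<exists>z\<in>pts (U k). i k z = w \<and> f k z = y" using j by blast
next
  fix z z' assume "z \<in> pts (U k)" "z' \<in> pts (U k)" "i k z = i k z'"
  thus "z = z'" using coproduct_inj[OF W k _ k] by blast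
qed (use assms in \<open>auto simp: is_coproductD\<close>)

text \<open>A point of the fibre product is a point of \<open>X\<close> together with the index of a
  copy, which is exactly a point of \<open>W\<close>. Cartesianness of this naturality square is
  what makes restriction compatible with folding.\<close>

lemma fold_pullback:
  assumes W: "is_coproduct G n (\<lambda>_. X) W i" and W': "is_coproduct G n (\<lambda>_. Y) W' i'"
    and X: "finite_gset G X" and Y: "finite_gset G Y"
    and h: "h \<in> ghom G W W'" and f: "f \<in> ghom G X Y"
    and hi: "\<And>k x. k < n \<Longrightarrow> x \<in> pts X \<Longrightarrow> h (i k x) = i' k (f x)"
    and p: "p \<in> ghom G W X" "\<And>k x. k < n \<Longrightarrow> x \<in> pts X \<Longrightarrow> p (i k x) = x"
    and p': "p' \<in> ghom G W' Y" "\<And>k x. k < n \<Longrightarrow> x \<in> pts Y \<Longrightarrow> p' (i' k x) = x"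
  shows "is_pullback G W' Y W X p' f h p"
proof (rule is_pullbackI)
  fix w assume "w \<in> pts W"
  then obtain k x where "k < n" "x \<in> pts X" "w = i k x" by (rule coproduct_cases[OF W])
  thus "p' (h w) = f (p w)" using hi p p' ghom_closed[OF f] by simp
next
  fix w' x assume w': "w' \<in> pts W'" and x: "x \<in> pts X" and eq: "p' w' = f x"
  obtain k y where k: "k < n" "y \<in> pts Y" "w' = i' k y" using coproduct_cases[OF W' w'] .
  show "\<exists>z\<in>pts W. h z = w' \<and> p z = x"
    using k x eq hi p p' ghom_closed[OF is_coproductD(3)[OF W k(1)] x]
    by (intro bexI[of _ "i k x"]) auto
next
  fix w w' assume w: "w \<in> pts W" "w' \<in> pts W" and eq: "h w = h w'" "p w = p w'"
  obtain k x where k: "k < n" "x \<in> pts X" "w = i k x" using coproduct_cases[OF W w(1)] .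
  obtain k' x' where k': "k' < n" "x' \<in> pts X" "w' = i k' x'" using coproduct_cases[OF W w(2)] .
  have "k = k'" using coproduct_inj(1)[OF W' k(1) _ k'(1), of "f x" "f x'"] k k' eq hi
    by (simp add: ghom_closed[OF f])
  thus "w = w'" using k k' eq p by simp
qed (use assms in \<open>auto simp: is_coproductD\<close>)

text \<open>Finite G-sets are extensive: pulling the injections \<open>i k\<close> back along
  \<open>\<epsilon>\<close> cuts \<open>Z\<close> into the preimages of the summands.\<close>

lemma coproduct_base_change:
  fixes Z W :: "('g, 'x::infinite) gset"
  assumes W: "is_coproduct G n U W i" and Z: "finite_gset G Z" and \<epsilon>: "\<epsilon> \<in> ghom G Z W"
  obtains V j l where "is_coproduct G n V Z j"
    "\<And>k. k < n \<Longrightarrow> l k \<in> ghom G (V k) (U k)"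
    "\<And>k. k < n \<Longrightarrow> gcomp (V k) \<epsilon> (j k) = gcomp (V k) (i k) (l k)"
proof -
  note D = is_coproductD[OF W]
  have "\<exists>V j l. is_pullback G Z W V (U k) \<epsilon> (i k) j l" if "k < n" for k
    using pullback_exists[OF Z D(1) D(2)[OF that] \<epsilon> D(3)[OF that]] by metis
  then obtain V j l where P: "\<And>k. k < n \<Longrightarrow> is_pullback G Z W (V k) (U k) \<epsilon> (i k) (j k) (l k)"
    by metis
  note PD = is_pullbackD[OF P]
  have eq: "\<epsilon> (j k x) = i k (l k x)" if "k < n" "x \<in> pts (V k)" for k x
    using PD(9)[OF that] .
  have "is_coproduct G n V Z j"
  proof (rule is_coproductI)
    fix z assume z: "z \<in> pts Z"
    obtain k x where k: "k < n" "x \<in> pts (U k)" "\<epsilon> z = i k x"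
      using coproduct_cases[OF W ghom_closed[OF \<epsilon> z]] .
    show "\<exists>k x. k < n \<and> x \<in> pts (V k) \<and> z = j k x" using PD(10)[OF k(1) z k(2,3)] k(1) by blast
  next
    fix k x k' x' assume *: "k < n" "x \<in> pts (V k)" "k' < n" "x' \<in> pts (V k')" "j k x = j k' x'"
    have "i k (l k x) = i k' (l k' x')" using eq[OF *(1,2)] eq[OF *(3,4)] *(5) by simp
    hence "k = k'" "l k x = l k' x'"
      using coproduct_inj[OF W *(1) _ *(3)] * ghom_closed[OF PD(8)] by blast+
    thus "k = k' \<and> x = x'" using PD(11)[OF *(1)] * by auto
  qed (use Z PD in auto)
  moreover have "gcomp (V k) \<epsilon> (j k) = gcomp (V k) (i k) (l k)" if "k < n" for k
    using eq[OF that] by (auto simp: compose_def)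
  ultimately show thesis using that PD(8) by blast
qed

section \<open>Sections over fibres and exponential diagrams\<close>

lemma section_gset_finite:
  assumes A: "finite_gset G A" and X: "finite_gset G X" and Y: "finite_gset G Y"
    and p: "p \<in> ghom G A X" and f: "f \<in> ghom G X Y"
  shows "finite_gset G (section_gset G A X Y p f)"
proof -
  interpret group G using X finite_gset_group by blast
  define P where "P = {(y, \<sigma>). y \<in> pts Y \<and> \<sigma> \<in> fibre X f y \<rightarrow>\<^sub>E pts A \<and> (\<forall>x\<in>fibre X f y. p (\<sigma> x) = x)}"
  let ?c = "\<lambda>g y \<sigma>. \<lambda>x\<in>fibre X f (act Y g y). act A g (\<sigma> (act X (inv\<^bsub>G\<^esub> g) x))"
  have S: "section_gset G A X Y p f = \<lparr>pts = P, act = (\<lambda>g. \<lambda>(y, \<sigma>)\<in>P. (act Y g y, ?c g y \<sigma>))\<rparr>"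
    unfolding section_gset_def P_def Let_def ..
  have P_dest: "y \<in> pts Y" if "(y, \<sigma>) \<in> P" for y \<sigma>
    using that by (simp add: P_def)
  \<comment> \<open>The inverse of \<open>g\<close> carries the fibre over the translated point back
    to the fibre over \<open>y\<close>, so the conjugated section evaluates \<open>\<sigma>\<close>
    inside its domain.\<close>
  have fib: "act X (inv\<^bsub>G\<^esub> g) x \<in> fibre X f y" if "g \<in> carrier G" "y \<in> pts Y" "x \<in> fibre X f (act Y g y)" for g x y
    using that act_closed[OF X] ghom_act[OF f] act_inv_cancel[OF Y] by (auto simp: fibre_def)
  have cl: "(act Y g y, ?c g y \<sigma>) \<in> P" if "g \<in> carrier G" "(y, \<sigma>) \<in> P" for g y \<sigma>
  proof -
    have "\<sigma> (act X (inv\<^bsub>G\<^esub> g) x) \<in> pts A" "p (\<sigma> (act X (inv\<^bsub>G\<^esub> g) x)) = act X (inv\<^bsub>G\<^esub> g) x"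
      if "x \<in> fibre X f (act Y g y)" for x
      using that \<open>(y, \<sigma>) \<in> P\<close> fib[OF \<open>g \<in> carrier G\<close> _ that] by (auto simp: P_def)
    thus ?thesis using that act_closed[OF Y] act_closed[OF A] ghom_act[OF p] act_inv_cancel[OF X]
      by (auto simp: P_def fibre_def)
  qed
  have "finite P"
  proof (rule finite_subset)
    show "P \<subseteq> (SIGMA y:pts Y. fibre X f y \<rightarrow>\<^sub>E pts A)" by (auto simp: P_def)
    have "finite (fibre X f y)" for y using finite_gset_finite[OF X] by (simp add: fibre_def)
    thus "finite (SIGMA y:pts Y. fibre X f y \<rightarrow>\<^sub>E pts A)"
      using finite_gset_finite[OF A] finite_gset_finite[OF Y] by (auto intro!: finite_SigmaI finite_PiE)
  qed
  moreover have "?c \<one>\<^bsub>G\<^esub> y \<sigma> = \<sigma>" if "(y, \<sigma>) \<in> P" for y \<sigma>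
  proof (rule extensionalityI[where A = "fibre X f y"])
    fix x assume "x \<in> fibre X f y"
    thus "?c \<one>\<^bsub>G\<^esub> y \<sigma> x = \<sigma> x"
      using that act_one[OF X] act_one[OF Y] act_one[OF A] by (auto simp: P_def fibre_def PiE_iff)
  qed (use that act_one[OF Y] in \<open>auto simp: P_def PiE_def\<close>)
  moreover have "?c (g \<otimes>\<^bsub>G\<^esub> h) y \<sigma> = ?c g (act Y h y) (?c h y \<sigma>)"
    if g: "g \<in> carrier G" and h: "h \<in> carrier G" and P: "(y, \<sigma>) \<in> P" for g h y \<sigma>
  proof -
    have y: "y \<in> pts Y" using P by (simp add: P_def)
    have "act A (g \<otimes>\<^bsub>G\<^esub> h) (\<sigma> (act X (inv\<^bsub>G\<^esub> (g \<otimes>\<^bsub>G\<^esub> h)) x)) = act A g (?c h y \<sigma> (act X (inv\<^bsub>G\<^esub> g) x))"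
      if x: "x \<in> fibre X f (act Y g (act Y h y))" for x
    proof -
      have f1: "act X (inv\<^bsub>G\<^esub> g) x \<in> fibre X f (act Y h y)"
        using fib[OF g act_closed[OF Y h y] x] .
      have "\<sigma> (act X (inv\<^bsub>G\<^esub> h) (act X (inv\<^bsub>G\<^esub> g) x)) \<in> pts A"
        using fib[OF h y f1] P by (auto simp: P_def)
      moreover have "act X (inv\<^bsub>G\<^esub> (g \<otimes>\<^bsub>G\<^esub> h)) x = act X (inv\<^bsub>G\<^esub> h) (act X (inv\<^bsub>G\<^esub> g) x)"
        using x g h by (simp add: inv_mult_group act_mult[OF X] fibre_def)
      ultimately show ?thesis using f1 g h by (simp add: act_mult[OF A])
    qed
    thus ?thesis using act_mult[OF Y g h y] by (auto simp: fun_eq_iff)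
  qed
  ultimately show ?thesis unfolding S
    using cl by (intro finite_gsetI)
      (auto simp del: restrict_apply simp: restrict_apply' act_one[OF Y] act_mult[OF Y] P_dest)
qed

text \<open>\<open>P\<close> is a copy over \<open>'x\<close> of the G-set of sections,
  \<open>Z\<close> a pull-back of \<open>f\<close> along \<open>\<pi>\<close>, and
  \<open>\<epsilon>\<close> evaluates the section at the point.\<close>

lemma exponential_exists:
  fixes X :: "('g, 'x::infinite) gset"
  assumes A: "finite_gset G A" and X: "finite_gset G X" and Y: "finite_gset G Y"
    and p: "p \<in> ghom G A X" and f: "f \<in> ghom G X Y"
  obtains P Z \<pi> \<rho> \<epsilon> where "is_exponential G A X Y P Z p f \<pi> \<rho> \<epsilon>"
    "finite_gset G P" "finite_gset G Z" "\<pi> \<in> ghom G P Y" "\<rho> \<in> ghom G Z P" "\<epsilon> \<in> ghom G Z A"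
proof -
  interpret group G using X finite_gset_group by blast
  let ?S = "section_gset G A X Y p f"
  note S = section_gset_finite[OF A X Y p f]
  obtain P :: "('g, 'x) gset" and e where P: "finite_gset G P" "e \<in> ghom G P ?S" "bij_betw e (pts P) (pts ?S)"
    using gset_transport[OF S] by blast
  have e: "fst (e w) \<in> pts Y" "x \<in> fibre X f (fst (e w)) \<Longrightarrow> snd (e w) x \<in> pts A" if "w \<in> pts P" for w x
    using ghom_closed[OF P(2) that] by (auto simp: section_gset_def Let_def)
  have eact: "e (act P g w) = (act Y g (fst (e w)), \<lambda>x\<in>fibre X f (act Y g (fst (e w))).
      act A g (snd (e w) (act X (inv\<^bsub>G\<^esub> g) x)))"
    if "g \<in> carrier G" "w \<in> pts P" for g w
    using ghom_act[OF P(2) that] ghom_closed[OF P(2) that(2)] by (auto simp: section_gset_def Let_def)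
  define \<pi> where "\<pi> = restrict (\<lambda>w. fst (e w)) (pts P)"
  have \<pi>: "\<pi> \<in> ghom G P Y"
    unfolding \<pi>_def using e eact by (intro ghom_restrictI P) auto
  obtain Z u \<rho> where Z: "is_pullback G X Y Z P f \<pi> u \<rho>"
    using pullback_exists[OF X Y P(1) f \<pi>] .
  note ZD = is_pullbackD[OF Z]
  define \<epsilon> where "\<epsilon> = restrict (\<lambda>z. snd (e (\<rho> z)) (u z)) (pts Z)"
  have fib: "u z \<in> fibre X f (fst (e (\<rho> z)))" if "z \<in> pts Z" for z
    using that ZD(9)[OF that] ghom_closed[OF ZD(7) that] ghom_closed[OF ZD(8) that]
    by (simp add: fibre_def \<pi>_def)
  have \<epsilon>: "\<epsilon> \<in> ghom G Z A"
    unfolding \<epsilon>_def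
  proof (rule ghom_restrictI[OF ZD(3)])
    fix z assume z: "z \<in> pts Z"
    note \<rho>z = ghom_closed[OF ZD(8) z]
    show "snd (e (\<rho> z)) (u z) \<in> pts A" using e(2)[OF \<rho>z fib[OF z]] .
    fix g assume g: "g \<in> carrier G"
    \<comment> \<open>Equivariance of evaluation: the conjugated section is evaluated at a
      translated point, where the inverse of \<open>g\<close> cancels \<open>g\<close>. This
      membership is what allows the \<open>restrict\<close> in \<open>eact\<close> to be
      reduced.\<close>
    have "act X g (u z) \<in> fibre X f (act Y g (fst (e (\<rho> z))))"
      using fib[OF z] g act_closed[OF X] ghom_act[OF f] by (simp add: fibre_def)
    thus "snd (e (\<rho> (act Z g z))) (u (act Z g z)) = act A g (snd (e (\<rho> z)) (u z))"
      using fib[OF z] g by (simp add: ghom_act[OF ZD(8) g z] ghom_act[OF ZD(7) g z] eact[OF g \<rho>z]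
          act_inv_cancel[OF X] fibre_def)
  qed
  have "is_exponential G A X Y P Z p f \<pi> \<rho> \<epsilon>"
    unfolding is_exponential_def
    using A p \<epsilon> P Z by (auto intro!: exI[of _ e] exI[of _ u] simp: \<pi>_def[symmetric]) (auto simp: \<pi>_def \<epsilon>_def)
  thus thesis using that P(1) ZD \<pi> \<epsilon> by blast
qed

section \<open>Semi-Mackey functors\<close>

text \<open>The codiagonal of the \<open>n\<close>-fold coproduct. The condition on \<open>p\<close>
  is pointwise; for \<open>n = 2\<close> it amounts to the \<open>gcomp\<close> equations in
  \<open>bif_op\<close>.\<close>

definition fold_map :: "nat \<Rightarrow> (nat \<Rightarrow> 'x \<Rightarrow> 'x) \<Rightarrow> ('g, 'c) monoid_scheme \<Rightarrow> ('g, 'x) gset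
    \<Rightarrow> ('g, 'x) gset \<Rightarrow> ('x \<Rightarrow> 'x) \<Rightarrow> bool" where
  "fold_map n i G W X p \<longleftrightarrow> is_coproduct G n (\<lambda>_. X) W i \<and> p \<in> ghom G W X \<and>
     (\<forall>k<n. \<forall>x\<in>pts X. p (i k x) = x)"

lemma fold_mapD:
  assumes "fold_map n i G W X p"
  shows "is_coproduct G n (\<lambda>_. X) W i" "p \<in> ghom G W X" "finite_gset G W"
    "\<lbrakk>k < n; x \<in> pts X\<rbrakk> \<Longrightarrow> p (i k x) = x" "k < n \<Longrightarrow> i k \<in> ghom G X W"
  using assms is_coproductD unfolding fold_map_def by blast+

lemma fold_map_exists:
  fixes X :: "('g, 'x::infinite) gset"
  assumes X: "finite_gset G X"
  obtains W i p where "fold_map n i G W X p"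
proof -
  obtain W i where W: "is_coproduct G n (\<lambda>_. X) W i" by (rule coproduct_exists[OF X])
  obtain p where "p \<in> ghom G W X" "\<And>k x. k < n \<Longrightarrow> x \<in> pts X \<Longrightarrow> p (i k x) = gid X x"
    by (rule coproduct_desc[OF W, of "\<lambda>_. gid X"]) (auto simp: gid_ghom[OF X])
  thus thesis using W that[of i W p] by (simp add: fold_map_def gid_def)
qed

context semi_mackey_functor
begin

lemma res_mem: "\<lbrakk>finite_gset G X; finite_gset G Y; f \<in> ghom G X Y; a \<in> obj M Y\<rbrakk> \<Longrightarrow> res M X Y f a \<in> obj M X"
  using res_closed by blast

lemma ind_mem: "\<lbrakk>finite_gset G X; finite_gset G Y; f \<in> ghom G X Y; a \<in> obj M X\<rbrakk> \<Longrightarrow> ind M X Y f a \<in> obj M Y"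
  using ind_closed by blast

lemma coproduct_ext:
  assumes "is_coproduct G n U W i" "a \<in> obj M W" "b \<in> obj M W"
    "\<And>k. k < n \<Longrightarrow> res M (U k) W (i k) a = res M (U k) W (i k) b"
  shows "a = b"
proof (rule inj_onD)
  show "inj_on (\<lambda>a. \<lambda>k\<in>{..<n}. res M (U k) W (i k) a) (obj M W)"
    using coproduct[OF assms(1)] by (simp add: bij_betw_def)
qed (use assms in auto)

lemma coproduct_lift:
  assumes "is_coproduct G n U W i" "\<And>k. k < n \<Longrightarrow> a k \<in> obj M (U k)"
  obtains c where "c \<in> obj M W" "\<And>k. k < n \<Longrightarrow> res M (U k) W (i k) c = a k"
proof -
  have "(\<lambda>k\<in>{..<n}. a k) \<in> (\<lambda>a. \<lambda>k\<in>{..<n}. res M (U k) W (i k) a) ` obj M W"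
    using coproduct[OF assms(1)] assms(2) by (auto simp: bij_betw_def)
  then obtain c where c: "c \<in> obj M W" "(\<lambda>k\<in>{..<n}. a k) = (\<lambda>k\<in>{..<n}. res M (U k) W (i k) c)"
    by blast
  have "res M (U k) W (i k) c = a k" if "k < n" for k
    using fun_cong[OF c(2), of k] that by simp
  thus thesis using c that by blast
qed

text \<open>With \<open>h\<close> the coproduct of \<open>n\<close> copies of \<open>f\<close>, the
  hypothesis on components forces \<open>c\<close> to be the restriction of \<open>c'\<close> along
  \<open>h\<close>, and base change along \<open>fold_pullback\<close> finishes. The case of the
  identity gives independence of the chosen coproduct; general \<open>f\<close> gives compatibility
  of restriction with the operation.\<close>

lemma res_fold_map:
  assumes p: "fold_map n i G W X p" and p': "fold_map n i' G W' Y p'"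
    and X: "finite_gset G X" and Y: "finite_gset G Y" and f: "f \<in> ghom G X Y"
    and c: "c \<in> obj M W" "c' \<in> obj M W'"
    and eq: "\<And>k. k < n \<Longrightarrow> res M X W (i k) c = res M X Y f (res M Y W' (i' k) c')"
  shows "res M X Y f (ind M W' Y p' c') = ind M W X p c"
proof -
  note D = fold_mapD[OF p] and D' = fold_mapD[OF p']
  obtain h where h: "h \<in> ghom G W W'"
      "\<And>k x. k < n \<Longrightarrow> x \<in> pts X \<Longrightarrow> h (i k x) = gcomp X (i' k) f x"
    by (rule coproduct_desc[OF D(1), of "\<lambda>k. gcomp X (i' k) f" W']) (auto intro: gcomp_ghom X f D'(5))
  have "res M W W' h c' = c"
  proof (rule coproduct_ext[OF D(1)])
    fix k assume k: "k < n"
    have "gcomp X h (i k) = gcomp X (i' k) f"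
      using h(2)[OF k] by (auto simp: compose_def fun_eq_iff)
    hence "res M X W (i k) (res M W W' h c') = res M X Y f (res M Y W' (i' k) c')"
      using res_comp[OF X D(3) D'(3) D(5)[OF k] h(1) c(2)] res_comp[OF X Y D'(3) f D'(5)[OF k] c(2)]
      by simp
    thus "res M X W (i k) (res M W W' h c') = res M X W (i k) c" using eq k by simp
  qed (use res_mem D D' h c in auto)
  moreover have "is_pullback G W' Y W X p' f h p"
    using h D D' X Y f by (intro fold_pullback[of G n X W i Y W' i']) (auto simp: compose_def)
  ultimately show ?thesis using pullback c(2) by metis
qed

lemma bif_op_eq:
  assumes p: "fold_map 2 i G W X p" and c: "c \<in> obj M W"
  shows "bif_op G M X (res M X W (i 0) c) (res M X W (i 1) c) = ind M W X p c"
  unfolding bif_op_def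
proof (rule the_equality)
  note D = fold_mapD[OF p]
  have X: "finite_gset G X" using is_coproductD(2)[OF D(1), of 0] by simp
  have "gcomp X p (i k) = gid X" if "k < 2" for k
    using D(4)[OF that] by (auto simp: compose_def gid_def fun_eq_iff)
  thus "\<exists>W' i' fold c'. is_coproduct G 2 (\<lambda>_. X) W' i' \<and> fold \<in> ghom G W' X \<and>
      gcomp X fold (i' 0) = gid X \<and> gcomp X fold (i' 1) = gid X \<and> c' \<in> obj M W' \<and>
      res M X W' (i' 0) c' = res M X W (i 0) c \<and> res M X W' (i' 1) c' = res M X W (i 1) c \<and>
      ind M W X p c = ind M W' X fold c'"
    using D c by (intro exI[of _ W] exI[of _ i] exI[of _ p] exI[of _ c]) simp
  fix r assume "\<exists>W' i' fold c'. is_coproduct G 2 (\<lambda>_. X) W' i' \<and> fold \<in> ghom G W' X \<and>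
      gcomp X fold (i' 0) = gid X \<and> gcomp X fold (i' 1) = gid X \<and> c' \<in> obj M W' \<and>
      res M X W' (i' 0) c' = res M X W (i 0) c \<and> res M X W' (i' 1) c' = res M X W (i 1) c \<and>
      r = ind M W' X fold c'"
  then obtain W' i' p' c' where
    *: "is_coproduct G 2 (\<lambda>_. X) W' i'" "p' \<in> ghom G W' X"
      "gcomp X p' (i' 0) = gid X" "gcomp X p' (i' 1) = gid X" "c' \<in> obj M W'"
      "res M X W' (i' 0) c' = res M X W (i 0) c" "res M X W' (i' 1) c' = res M X W (i 1) c"
      "r = ind M W' X p' c'" by blast
  have "p' (i' k x) = x" if "k < 2" "x \<in> pts X" for k x
    using that fun_cong[OF *(3), of x] fun_cong[OF *(4), of x]
    by (auto simp: compose_def gid_def less_2_cases_iff)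
  hence p': "fold_map 2 i' G W' X p'" using * by (simp add: fold_map_def)
  note D' = fold_mapD[OF p']
  have "res M X W (i k) c = res M X X (gid X) (res M X W' (i' k) c')" if "k < 2" for k
    using that *(6,7) res_id[OF X res_mem[OF X D'(3,5) *(5)]] by (auto simp: less_2_cases_iff)
  \<comment> \<open>Two competing descriptions of the value are compared over the identity of
    \<open>X\<close>, which makes the \<open>THE\<close> well defined.\<close>
  from res_fold_map[OF p p' X X gid_ghom[OF X] c *(5) this]
  show "r = ind M W X p c" using *(5,8) by (simp add: res_id[OF X] ind_mem[OF D'(3) X D'(2)])
qed

lemma bif_op_repr:
  assumes X: "finite_gset G X" and a: "a \<in> obj M X" and b: "b \<in> obj M X"
  obtains W i p c where "fold_map 2 i G W X p" "c \<in> obj M W" "res M X W (i 0) c = a" "res M X W (i 1) c = b"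
    "bif_op G M X a b = ind M W X p c"
proof -
  obtain W i p where p: "fold_map 2 i G W X p" by (rule fold_map_exists[OF X])
  obtain c where c: "c \<in> obj M W"
      "\<And>k. k < 2 \<Longrightarrow> res M X W (i k) c = (if k = 0 then a else b)"
    by (rule coproduct_lift[OF fold_mapD(1)[OF p], of "\<lambda>k. if k = 0 then a else b"]) (use a b in auto)
  have "res M X W (i 0) c = a" "res M X W (i 1) c = b" using c(2)[of 0] c(2)[of 1] by auto
  thus thesis using that p c(1) bif_op_eq[OF p c(1)] by simp
qed

lemma bif_op_closed:
  assumes X: "finite_gset G X" and a: "a \<in> obj M X" and b: "b \<in> obj M X"
  shows "bif_op G M X a b \<in> obj M X"
  using bif_op_repr[OF assms] ind_mem X fold_mapD(2,3) by metis

text \<open>Exchanging the two injections yields another coproduct with the same folding map.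
  Needing only a semi-Mackey functor, this also covers the multiplication of
  \<open>tring\<close>.\<close>

lemma bif_op_comm:
  assumes X: "finite_gset G X" and a: "a \<in> obj M X" and b: "b \<in> obj M X"
  shows "bif_op G M X a b = bif_op G M X b a"
proof -
  obtain W i p c where p: "fold_map 2 i G W X p" and c: "c \<in> obj M W" "res M X W (i 0) c = a" "res M X W (i 1) c = b"
    and eq: "bif_op G M X a b = ind M W X p c" by (rule bif_op_repr[OF assms])
  note D = fold_mapD[OF p]
  have "is_coproduct G 2 (\<lambda>_. X) W (\<lambda>k. i (1 - k))"
  proof (rule is_coproductI)
    fix w assume "w \<in> pts W"
    then obtain k x where "k < 2" "x \<in> pts X" "w = i k x" by (rule coproduct_cases[OF D(1)])
    thus "\<exists>k x. k < 2 \<and> x \<in> pts X \<and> w = i (1 - k) x"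
      by (intro exI[of _ "1 - k"] exI[of _ x]) (auto simp: less_2_cases_iff)
  next
    fix k x k' x'
    assume *: "k < (2::nat)" "x \<in> pts X" "k' < (2::nat)" "x' \<in> pts X" "i (1 - k) x = i (1 - k') x'"
    thus "k = k' \<and> x = x'"
      using coproduct_inj[OF D(1), of "1 - k" x "1 - k'" x'] by (auto simp: less_2_cases_iff)
  qed (use D X in auto)
  hence "fold_map 2 (\<lambda>k. i (1 - k)) G W X p"
    using D by (simp add: fold_map_def)
  from bif_op_eq[OF this c(1)] c(2,3) eq show ?thesis by simp
qed

text \<open>\<open>\<rho>\<close> factors as the folding map of \<open>P\<close> after the coproduct
  of its two restrictions; induction along the former is the operation, and base change identifies
  the components of induction along the latter. For the multiplicative part: a norm from a disjoint
  union is the product of the norms.\<close>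

lemma ind_coproduct:
  assumes Z: "is_coproduct G 2 V Z j" and P: "finite_gset G P" and \<rho>: "\<rho> \<in> ghom G Z P" and e: "e \<in> obj M Z"
  shows "ind M Z P \<rho> e = bif_op G M P
    (ind M (V 0) P (gcomp (V 0) \<rho> (j 0)) (res M (V 0) Z (j 0) e))
    (ind M (V 1) P (gcomp (V 1) \<rho> (j 1)) (res M (V 1) Z (j 1) e))"
proof -
  note D = is_coproductD[OF Z]
  obtain W i p where p: "fold_map 2 i G W P p" by (rule fold_map_exists[OF P])
  note pD = fold_mapD[OF p]
  let ?\<rho> = "\<lambda>k. gcomp (V k) \<rho> (j k)"
  have \<rho>k: "?\<rho> k \<in> ghom G (V k) P" if "k < 2" for k
    using that D \<rho> by (auto intro: gcomp_ghom)
  obtain h where h: "h \<in> ghom G Z W"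
      "\<And>k x. k < 2 \<Longrightarrow> x \<in> pts (V k) \<Longrightarrow> h (j k x) = gcomp (V k) (i k) (?\<rho> k) x"
    by (rule coproduct_desc[OF Z, of "\<lambda>k. gcomp (V k) (i k) (?\<rho> k)" W])
      (rule gcomp_ghom[OF D(2) \<rho>k pD(5)], assumption+, blast)
  have hj: "h (j k x) = i k (?\<rho> k x)" if "k < 2" "x \<in> pts (V k)" for k x
    using h(2)[OF that] that by (simp add: compose_def)
  have "gcomp Z p h = \<rho>"
  proof (rule ghom_eqI[OF gcomp_ghom[OF D(1) h(1) pD(2)] \<rho>])
    fix z assume z: "z \<in> pts Z"
    obtain k x where k: "k < 2" "x \<in> pts (V k)" "z = j k x" by (rule coproduct_cases[OF Z z])
    show "gcomp Z p h z = \<rho> z"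
      using k z hj[OF k(1,2)] pD(4)[OF k(1) ghom_closed[OF \<rho>k[OF k(1)] k(2)]] by (simp add: compose_def)
  qed
  hence "ind M Z P \<rho> e = ind M W P p (ind M Z W h e)"
    using ind_comp[OF D(1) pD(3) P h(1) pD(2) e] by simp
  also have "\<dots> = bif_op G M P (res M P W (i 0) (ind M Z W h e)) (res M P W (i 1) (ind M Z W h e))"
    using bif_op_eq[OF p ind_mem[OF D(1) pD(3) h(1) e]] by simp
  finally show ?thesis
    using pullback[OF coproduct_map_pullback[OF Z pD(1) h(1) \<rho>k hj] e, of 0]
      pullback[OF coproduct_map_pullback[OF Z pD(1) h(1) \<rho>k hj] e, of 1] by simp
qed

text \<open>The composite of \<open>f\<close> with the folding map restricts to \<open>f\<close> on
  both copies, so this is \<open>ind_coproduct\<close> for that composite.\<close>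

lemma ind_bif_op:
  assumes X: "finite_gset G X" and Y: "finite_gset G Y" and f: "f \<in> ghom G X Y"
    and a: "a \<in> obj M X" and b: "b \<in> obj M X"
  shows "ind M X Y f (bif_op G M X a b) = bif_op G M Y (ind M X Y f a) (ind M X Y f b)"
proof -
  obtain W i p c where p: "fold_map 2 i G W X p" and c: "c \<in> obj M W" "res M X W (i 0) c = a" "res M X W (i 1) c = b"
    and eq: "bif_op G M X a b = ind M W X p c" by (rule bif_op_repr[OF X a b])
  note D = fold_mapD[OF p]
  have fk: "gcomp X (gcomp W f p) (i k) = f" if "k < 2" for k
    using that by (intro ghom_eqI[OF gcomp_ghom[OF X D(5) gcomp_ghom[OF D(3,2) f]] f])
      (auto simp: compose_def D ghom_closed[OF D(5)])
  have "ind M X Y f (ind M W X p c) = ind M W Y (gcomp W f p) c"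
    using ind_comp[OF D(3) X Y D(2) f c(1)] by simp
  also have "\<dots> = bif_op G M Y (ind M X Y f a) (ind M X Y f b)"
    using ind_coproduct[OF D(1) Y gcomp_ghom[OF D(3,2) f] c(1)] c fk by simp
  finally show ?thesis using eq by simp
qed

lemma res_bif_op:
  assumes X: "finite_gset G X" and Y: "finite_gset G Y" and f: "f \<in> ghom G X Y"
    and a: "a \<in> obj M Y" and b: "b \<in> obj M Y"
  shows "res M X Y f (bif_op G M Y a b) = bif_op G M X (res M X Y f a) (res M X Y f b)"
proof -
  obtain W' i' p' c' where p': "fold_map 2 i' G W' Y p'"
    and c': "c' \<in> obj M W'" "res M Y W' (i' 0) c' = a" "res M Y W' (i' 1) c' = b"
    and eq': "bif_op G M Y a b = ind M W' Y p' c'" by (rule bif_op_repr[OF Y a b])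
  obtain W i p c where p: "fold_map 2 i G W X p"
    and c: "c \<in> obj M W" "res M X W (i 0) c = res M X Y f a" "res M X W (i 1) c = res M X Y f b"
    and eq: "bif_op G M X (res M X Y f a) (res M X Y f b) = ind M W X p c"
    by (rule bif_op_repr[OF X res_mem[OF X Y f a] res_mem[OF X Y f b]])
  show ?thesis
    unfolding eq eq'
    by (rule res_fold_map[OF p p' X Y f c(1) c'(1)]) (auto simp: c[unfolded One_nat_def] c'[unfolded One_nat_def] less_2_cases_iff)
qed

section \<open>The empty G-set and units\<close>

lemma empty_coproduct: "finite_gset G E \<Longrightarrow> pts E = {} \<Longrightarrow> is_coproduct G 0 U E i"
  by (rule is_coproductI) auto

text \<open>The coproduct axiom for \<open>n = 0\<close> compares \<open>obj M E\<close> with the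
  one-element empty product.\<close>

lemma empty_obj:
  assumes "finite_gset G E" "pts E = {}"
  obtains c where "obj M E = {c}"
proof -
  have W: "is_coproduct G 0 (\<lambda>_. E) E (\<lambda>_ x. x)" by (rule empty_coproduct[OF assms])
  obtain c where c: "c \<in> obj M E" by (rule coproduct_lift[OF W]) auto
  moreover have "a = c" if "a \<in> obj M E" for a by (rule coproduct_ext[OF W that c]) auto
  ultimately show thesis using that by blast
qed

text \<open>A square whose left-hand column is empty is a pull-back. Over the identity this makes
  \<open>bif_unit\<close> independent of the empty G-set; in general it says that restriction
  preserves units.\<close>

lemma res_ind_empty:
  assumes E: "finite_gset G E" "pts E = {}" and E': "finite_gset G E'" "pts E' = {}"
    and X: "finite_gset G X" and Y: "finite_gset G Y" and f: "f \<in> ghom G X Y"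
    and c: "c \<in> obj M E" and c': "c' \<in> obj M E'"
  shows "res M X Y f (ind M E' Y (\<lambda>_. undefined) c') = ind M E X (\<lambda>_. undefined) c"
proof -
  have "is_pullback G E' Y E X (\<lambda>_. undefined) f (\<lambda>_. undefined) (\<lambda>_. undefined)"
    using assms by (intro is_pullbackI) (auto simp: ghom_empty)
  from pullback[OF this c'] show ?thesis
    using empty_obj[OF E] c res_mem[OF E(1) E'(1) ghom_empty[OF E(2)] c'] by (metis singletonD)
qed

lemma bif_unit_eq:
  assumes X: "finite_gset G X" and E: "finite_gset G E" "pts E = {}" and c: "c \<in> obj M E"
  shows "bif_unit G M X = ind M E X (\<lambda>_. undefined) c"
  unfolding bif_unit_def
proof (rule the_equality)
  fix r assume "\<exists>E c. finite_gset G E \<and> pts E = {} \<and> c \<in> obj M E \<and> r = ind M E X (\<lambda>_. undefined) c"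
  then obtain E' c' where *: "finite_gset G E'" "pts E' = {}" "c' \<in> obj M E'"
    and r: "r = ind M E' X (\<lambda>_. undefined) c'" by blast
  show "r = ind M E X (\<lambda>_. undefined) c"
    using res_ind_empty[OF E *(1,2) X X gid_ghom[OF X] c *(3)] r
    by (simp add: res_id[OF X] ind_mem[OF *(1) X ghom_empty[OF *(2)] *(3)])
qed (use assms in blast)

lemma bif_unit_repr:
  assumes X: "finite_gset G X"
  obtains E c where "finite_gset G E" "pts E = {}" "c \<in> obj M E" "bif_unit G M X = ind M E X (\<lambda>_. undefined) c"
proof -
  let ?E = "\<lparr>pts = {}, act = \<lambda>_ _. undefined\<rparr> :: ('b, 'x) gset"
  have E: "finite_gset G ?E" by (rule finite_gset_empty) (rule is_group)
  obtain c where "c \<in> obj M ?E" using empty_obj[OF E] by auto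
  thus thesis using that[OF E] bif_unit_eq[OF X E] by simp
qed

lemma bif_unit_closed: "finite_gset G X \<Longrightarrow> bif_unit G M X \<in> obj M X"
  by (metis bif_unit_repr ind_mem ghom_empty)

lemma res_bif_unit:
  assumes X: "finite_gset G X" and Y: "finite_gset G Y" and f: "f \<in> ghom G X Y"
  shows "res M X Y f (bif_unit G M Y) = bif_unit G M X"
  using bif_unit_repr[OF X] bif_unit_repr[OF Y] res_ind_empty[OF _ _ _ _ X Y f] by metis

end

text \<open>Nothing is demanded of \<open>M\<close> or \<open>N\<close> beyond closure and
  naturality, so the notion can be used to prove that \<open>N\<close> is a semi-Mackey
  functor.\<close>

definition bifunctor_map ::
  "('g, 'c) monoid_scheme \<Rightarrow> ('g, 'x, 'm) bifunctor \<Rightarrow> ('g, 'x, 'n) bifunctor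
     \<Rightarrow> (('g, 'x) gset \<Rightarrow> 'm \<Rightarrow> 'n) \<Rightarrow> bool"
where
  "bifunctor_map G M N \<phi> \<longleftrightarrow>
     (\<forall>X. finite_gset G X \<longrightarrow> \<phi> X \<in> obj M X \<rightarrow> obj N X) \<and>
     (\<forall>X Y f. finite_gset G X \<and> finite_gset G Y \<and> f \<in> ghom G X Y \<longrightarrow>
        (\<forall>b\<in>obj M Y. \<phi> X (res M X Y f b) = res N X Y f (\<phi> Y b)) \<and>
        (\<forall>a\<in>obj M X. \<phi> Y (ind M X Y f a) = ind N X Y f (\<phi> X a)))"

lemma bifunctor_mapD:
  assumes "bifunctor_map G M N \<phi>" "finite_gset G X"
  shows "a \<in> obj M X \<Longrightarrow> \<phi> X a \<in> obj N X"
    and "\<lbrakk>finite_gset G Y; f \<in> ghom G X Y; b \<in> obj M Y\<rbrakk> \<Longrightarrow> res N X Y f (\<phi> Y b) = \<phi> X (res M X Y f b)"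
    and "\<lbrakk>finite_gset G Y; f \<in> ghom G X Y; a \<in> obj M X\<rbrakk> \<Longrightarrow> ind N X Y f (\<phi> X a) = \<phi> Y (ind M X Y f a)"
  using assms by (auto simp: bifunctor_map_def)

text \<open>The operation is built from restriction and induction alone, so naturality with respect
  to these already makes \<open>\<phi>\<close> a homomorphism.\<close>

lemma bifunctor_map_op:
  assumes M: "semi_mackey_functor G M" and N: "semi_mackey_functor G N" and \<phi>: "bifunctor_map G M N \<phi>"
    and X: "finite_gset G X" and a: "a \<in> obj M X" and b: "b \<in> obj M X"
  shows "\<phi> X (bif_op G M X a b) = bif_op G N X (\<phi> X a) (\<phi> X b)"
proof -
  interpret M: semi_mackey_functor G M by fact
  interpret N: semi_mackey_functor G N by fact
  note \<phi>D = bifunctor_mapD[OF \<phi>]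
  obtain W i p c where p: "fold_map 2 i G W X p" and c: "c \<in> obj M W" "res M X W (i 0) c = a" "res M X W (i 1) c = b"
    and eq: "bif_op G M X a b = ind M W X p c" by (rule M.bif_op_repr[OF X a b])
  note D = fold_mapD[OF p]
  have "res N X W (i k) (\<phi> W c) = \<phi> X (res M X W (i k) c)" if "k < 2" for k
    using \<phi>D(2)[OF X D(3,5) c(1)] that .
  from this[of 0] this[of 1] show ?thesis
    using N.bif_op_eq[OF p \<phi>D(1)[OF D(3) c(1)]] \<phi>D(3)[OF D(3) X D(2) c(1)] c eq by simp
qed

lemma bifunctor_map_unit:
  assumes M: "semi_mackey_functor G M" and N: "semi_mackey_functor G N" and \<phi>: "bifunctor_map G M N \<phi>"
    and X: "finite_gset G X"
  shows "\<phi> X (bif_unit G M X) = bif_unit G N X"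
proof -
  interpret M: semi_mackey_functor G M by fact
  interpret N: semi_mackey_functor G N by fact
  note \<phi>D = bifunctor_mapD[OF \<phi>]
  obtain E c where E: "finite_gset G E" "pts E = {}" "c \<in> obj M E"
    and eq: "bif_unit G M X = ind M E X (\<lambda>_. undefined) c" by (rule M.bif_unit_repr[OF X])
  show ?thesis
    using N.bif_unit_eq[OF X E(1,2) \<phi>D(1)[OF E(1,3)]] \<phi>D(3)[OF E(1) X ghom_empty[OF E(2)] E(3)] eq
    by simp
qed

text \<open>Elements with equal restrictions in \<open>N\<close> lift to elements of
  \<open>M\<close> whose restrictions merely have equal images; hence \<open>inj\<close> is assumed.
  The remaining axioms are equations or existence claims, verified on preimages.\<close>

lemma semi_mackey_image:
  fixes M :: "('g, 'x::infinite, 'm) bifunctor" and N :: "('g, 'x, 'n) bifunctor"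
  assumes M: "semi_mackey_functor G M" and \<phi>: "bifunctor_map G M N \<phi>"
    and surj: "\<And>X. finite_gset G X \<Longrightarrow> obj N X \<subseteq> \<phi> X ` obj M X"
    and inj: "\<And>n U W i a b. \<lbrakk>is_coproduct G n U W i; a \<in> obj N W; b \<in> obj N W;
       \<And>k. k < n \<Longrightarrow> res N (U k) W (i k) a = res N (U k) W (i k) b\<rbrakk> \<Longrightarrow> a = b"
  shows "semi_mackey_functor G N"
proof -
  interpret M: semi_mackey_functor G M by fact
  note \<phi>D = bifunctor_mapD[OF \<phi>]
  note mem = M.res_mem M.ind_mem
  show ?thesis
  proof unfold_locales
    show "finite (carrier G)" by (rule M.finite_group)
  next
    fix X Y :: "('g, 'x) gset" and f assume *: "finite_gset G X" "finite_gset G Y" "f \<in> ghom G X Y"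
    show "res N X Y f \<in> obj N Y \<rightarrow> obj N X"
    proof
      fix b assume "b \<in> obj N Y"
      then obtain b' where "b' \<in> obj M Y" "b = \<phi> Y b'" using surj[OF *(2)] by blast
      thus "res N X Y f b \<in> obj N X" using * \<phi>D(2)[OF *] by (simp add: mem \<phi>D(1))
    qed
    show "ind N X Y f \<in> obj N X \<rightarrow> obj N Y"
    proof
      fix a assume "a \<in> obj N X"
      then obtain a' where "a' \<in> obj M X" "a = \<phi> X a'" using surj[OF *(1)] by blast
      thus "ind N X Y f a \<in> obj N Y" using * \<phi>D(3)[OF *] by (simp add: mem \<phi>D(1))
    qed
  next
    fix X :: "('g, 'x) gset" and a assume X: "finite_gset G X" and "a \<in> obj N X"
    then obtain a' where a': "a' \<in> obj M X" "a = \<phi> X a'" using surj[OF X] by blast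
    thus "res N X X (gid X) a = a" "ind N X X (gid X) a = a"
      using \<phi>D(2,3)[OF X X gid_ghom[OF X]] M.res_id[OF X] M.ind_id[OF X] by auto
  next
    fix X Y Z :: "('g, 'x) gset" and f g a
    assume *: "finite_gset G X" "finite_gset G Y" "finite_gset G Z" "f \<in> ghom G X Y" "g \<in> ghom G Y Z"
      "a \<in> obj N Z"
    then obtain a' where a': "a' \<in> obj M Z" "a = \<phi> Z a'" using surj[OF *(3)] by blast
    thus "res N X Z (gcomp X g f) a = res N X Y f (res N Y Z g a)"
      using * \<phi>D(2) M.res_comp[OF *(1-5) a'(1)] by (simp add: gcomp_ghom mem)
  next
    fix X Y Z :: "('g, 'x) gset" and f g a
    assume *: "finite_gset G X" "finite_gset G Y" "finite_gset G Z" "f \<in> ghom G X Y" "g \<in> ghom G Y Z"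
      "a \<in> obj N X"
    then obtain a' where a': "a' \<in> obj M X" "a = \<phi> X a'" using surj[OF *(1)] by blast
    thus "ind N X Z (gcomp X g f) a = ind N Y Z g (ind N X Y f a)"
      using * \<phi>D(3) M.ind_comp[OF *(1-5) a'(1)] by (simp add: gcomp_ghom mem)
  next
    fix n and U :: "nat \<Rightarrow> ('g, 'x) gset" and W i assume W: "is_coproduct G n U W i"
    note D = is_coproductD[OF W]
    show "bij_betw (\<lambda>a. \<lambda>k\<in>{..<n}. res N (U k) W (i k) a) (obj N W) (\<Pi>\<^sub>E k\<in>{..<n}. obj N (U k))"
      unfolding bij_betw_def
    proof (intro conjI inj_onI equalityI subsetI)
      fix a b assume *: "a \<in> obj N W" "b \<in> obj N W"
        and eq: "(\<lambda>k\<in>{..<n}. res N (U k) W (i k) a) = (\<lambda>k\<in>{..<n}. res N (U k) W (i k) b)"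
      have "res N (U k) W (i k) a = res N (U k) W (i k) b" if "k < n" for k
        using fun_cong[OF eq, of k] that by simp
      thus "a = b" by (rule inj[OF W *])
    next
      fix y assume "y \<in> (\<lambda>a. \<lambda>k\<in>{..<n}. res N (U k) W (i k) a) ` obj N W"
      then obtain a where a: "a \<in> obj N W" "y = (\<lambda>k\<in>{..<n}. res N (U k) W (i k) a)" by blast
      obtain a' where a': "a' \<in> obj M W" "a = \<phi> W a'" using surj[OF D(1)] a by blast
      show "y \<in> (\<Pi>\<^sub>E k\<in>{..<n}. obj N (U k))"
        using D a a' \<phi>D(2) by (auto simp: mem \<phi>D(1))
    next
      fix y assume y: "y \<in> (\<Pi>\<^sub>E k\<in>{..<n}. obj N (U k))"
      \<comment> \<open>Surjectivity of the comparison map does pass to images: the components are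
        lifted to \<open>M\<close>, glued there, and the result is pushed forward.\<close>
      have "\<exists>x. x \<in> obj M (U k) \<and> y k = \<phi> (U k) x" if "k < n" for k
        using y surj[OF D(2)[OF that]] that by blast
      then obtain x where x: "\<And>k. k < n \<Longrightarrow> x k \<in> obj M (U k) \<and> y k = \<phi> (U k) (x k)" by metis
      obtain c where c: "c \<in> obj M W" "\<And>k. k < n \<Longrightarrow> res M (U k) W (i k) c = x k"
        by (rule M.coproduct_lift[OF W]) (use x in auto)
      have "y = (\<lambda>k\<in>{..<n}. res N (U k) W (i k) (\<phi> W c))"
        using y x c D \<phi>D(2) by (intro extensionalityI[of _ "{..<n}"]) (auto simp: PiE_def)
      thus "y \<in> (\<lambda>a. \<lambda>k\<in>{..<n}. res N (U k) W (i k) a) ` obj N W"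
        using c D \<phi>D(1) by blast
    qed
  next
    fix X Y X' Y' :: "('g, 'x) gset" and f \<eta> \<xi> f' a
    assume P: "is_pullback G X Y X' Y' f \<eta> \<xi> f'" and "a \<in> obj N X"
    then obtain a' where a': "a' \<in> obj M X" "a = \<phi> X a'" using surj[OF is_pullbackD(1)[OF P]] by blast
    thus "res N Y' Y \<eta> (ind N X Y f a) = ind N X' Y' f' (res N X' X \<xi> a)"
      using is_pullbackD(1-8)[OF P] \<phi>D(2,3) M.pullback[OF P a'(1)] by (simp add: mem)
  qed
qed

text \<open>Associativity, unit law and inverses are images of those in \<open>M\<close>. That
  \<open>N\<close> is semi-Mackey must come first: it makes \<open>bif_op\<close> on
  \<open>N\<close> meaningful and supplies closure and commutativity.\<close>

lemma mackey_image:
  fixes M :: "('g, 'x::infinite, 'm) bifunctor" and N :: "('g, 'x, 'n) bifunctor"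
  assumes M: "mackey_functor G M" and N: "semi_mackey_functor G N" and \<phi>: "bifunctor_map G M N \<phi>"
    and surj: "\<And>X. finite_gset G X \<Longrightarrow> obj N X \<subseteq> \<phi> X ` obj M X"
  shows "mackey_functor G N"
proof -
  interpret M: mackey_functor G M by fact
  interpret N: semi_mackey_functor G N by fact
  show ?thesis
  proof (intro mackey_functor.intro mackey_functor_axioms.intro N)
    fix X :: "('g, 'x) gset" assume X: "finite_gset G X"
    note op = bifunctor_map_op[OF M.semi_mackey_functor_axioms N \<phi> X]
    note unit = bifunctor_map_unit[OF M.semi_mackey_functor_axioms N \<phi> X]
    interpret A: comm_group "bif_monoid G M X" by (rule M.comm_group[OF X])
    have A: "carrier (bif_monoid G M X) = obj M X" "mult (bif_monoid G M X) = bif_op G M X"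
      "one (bif_monoid G M X) = bif_unit G M X" by (simp_all add: bif_monoid_def)
    have pre: "\<exists>x'\<in>obj M X. x = \<phi> X x'" if "x \<in> obj N X" for x using surj[OF X] that by blast
    show "comm_group (bif_monoid G N X)"
    proof (rule comm_groupI; unfold bif_monoid_def; simp)
      fix x y z assume "x \<in> obj N X" "y \<in> obj N X" "z \<in> obj N X"
      then obtain x' y' z' where "x' \<in> obj M X" "y' \<in> obj M X" "z' \<in> obj M X"
        "x = \<phi> X x'" "y = \<phi> X y'" "z = \<phi> X z'" using pre by metis
      thus "bif_op G N X (bif_op G N X x y) z = bif_op G N X x (bif_op G N X y z)"
        using A.m_assoc[unfolded A] M.bif_op_closed[OF X] by (simp add: op[symmetric])
    next
      fix x assume "x \<in> obj N X"
      then obtain x' where x': "x' \<in> obj M X" "x = \<phi> X x'" using pre by blast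
      thus "bif_op G N X (bif_unit G N X) x = x"
        using A.l_one[unfolded A] M.bif_unit_closed[OF X] by (simp add: op[symmetric] unit[symmetric])
      obtain y' where "y' \<in> obj M X" "bif_op G M X y' x' = bif_unit G M X"
        using A.l_inv_ex[unfolded A, OF x'(1)] by blast
      thus "\<exists>y\<in>obj N X. bif_op G N X y x = bif_unit G N X"
        using x' bifunctor_mapD(1)[OF \<phi> X] by (intro bexI[of _ "\<phi> X y'"]) (simp_all add: op[symmetric] unit)
    qed (simp_all add: N.bif_op_closed[OF X] N.bif_unit_closed[OF X] N.bif_op_comm[OF X])
  qed
qed

section \<open>Ideals and quotients of Tambara functors\<close>

lemma is_exponentialD:
  assumes "is_exponential G A X Y P Z p f \<pi> \<rho> \<epsilon>"
  shows "finite_gset G A" "finite_gset G X" "finite_gset G Y" "finite_gset G P" "finite_gset G Z"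
    "p \<in> ghom G A X" "f \<in> ghom G X Y" "\<pi> \<in> ghom G P Y" "\<rho> \<in> ghom G Z P" "\<epsilon> \<in> ghom G Z A"
proof -
  obtain u where u: "is_pullback G X Y Z P f \<pi> u \<rho>"
    using assms by (auto simp: is_exponential_def)
  note D = is_pullbackD[OF u]
  show "finite_gset G A" "p \<in> ghom G A X" "\<epsilon> \<in> ghom G Z A"
    using assms by (auto simp: is_exponential_def)
  show "finite_gset G X" "finite_gset G Y" "finite_gset G P" "finite_gset G Z"
    "f \<in> ghom G X Y" "\<pi> \<in> ghom G P Y" "\<rho> \<in> ghom G Z P" by (rule D)+
qed

text \<open>Unlike \<open>tambara_hom\<close>, this presupposes neither that source and target are
  Tambara functors nor that the maps are ring homomorphisms, so it is available for a target still
  to be recognised as a Tambara functor.\<close>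

definition tambara_map ::
  "('g, 'c) monoid_scheme \<Rightarrow> ('g, 'x, 'r) tambara \<Rightarrow> ('g, 'x, 's) tambara
     \<Rightarrow> (('g, 'x) gset \<Rightarrow> 'r \<Rightarrow> 's) \<Rightarrow> bool"
where
  "tambara_map G T S \<phi> \<longleftrightarrow> bifunctor_map G (add_part T) (add_part S) \<phi> \<and>
     bifunctor_map G (mul_part T) (mul_part S) \<phi>"

lemma tambara_mapI:
  assumes "\<And>X a. \<lbrakk>finite_gset G X; a \<in> tobj T X\<rbrakk> \<Longrightarrow> \<phi> X a \<in> tobj S X"
    and "\<And>X Y f b. \<lbrakk>finite_gset G X; finite_gset G Y; f \<in> ghom G X Y; b \<in> tobj T Y\<rbrakk>
      \<Longrightarrow> \<phi> X (tres T X Y f b) = tres S X Y f (\<phi> Y b)"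
    and "\<And>X Y f a. \<lbrakk>finite_gset G X; finite_gset G Y; f \<in> ghom G X Y; a \<in> tobj T X\<rbrakk>
      \<Longrightarrow> \<phi> Y (tadd T X Y f a) = tadd S X Y f (\<phi> X a)"
    and "\<And>X Y f a. \<lbrakk>finite_gset G X; finite_gset G Y; f \<in> ghom G X Y; a \<in> tobj T X\<rbrakk>
      \<Longrightarrow> \<phi> Y (tmul T X Y f a) = tmul S X Y f (\<phi> X a)"
  shows "tambara_map G T S \<phi>"
  using assms by (auto simp: tambara_map_def bifunctor_map_def add_part_def mul_part_def)

lemma tambara_mapD:
  assumes "tambara_map G T S \<phi>" "finite_gset G X"
  shows "a \<in> tobj T X \<Longrightarrow> \<phi> X a \<in> tobj S X"
    and "\<lbrakk>finite_gset G Y; f \<in> ghom G X Y; b \<in> tobj T Y\<rbrakk> \<Longrightarrow> \<phi> X (tres T X Y f b) = tres S X Y f (\<phi> Y b)"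
    and "\<lbrakk>finite_gset G Y; f \<in> ghom G X Y; a \<in> tobj T X\<rbrakk> \<Longrightarrow> \<phi> Y (tadd T X Y f a) = tadd S X Y f (\<phi> X a)"
    and "\<lbrakk>finite_gset G Y; f \<in> ghom G X Y; a \<in> tobj T X\<rbrakk> \<Longrightarrow> \<phi> Y (tmul T X Y f a) = tmul S X Y f (\<phi> X a)"
  using assms by (auto simp: tambara_map_def bifunctor_map_def add_part_def mul_part_def)

text \<open>The injectivity half of the coproduct axiom. It mentions only \<open>tres\<close>, which
  the additive and multiplicative parts share, so one condition serves both.\<close>

definition coproduct_separated :: "('g, 'c) monoid_scheme \<Rightarrow> ('g, 'x, 'r) tambara \<Rightarrow> bool" where
  "coproduct_separated G T \<longleftrightarrow> (\<forall>n U W i a b. is_coproduct G n U W i \<and> a \<in> tobj T W \<and> b \<in> tobj T W \<and>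
     (\<forall>k<n. tres T (U k) W (i k) a = tres T (U k) W (i k) b) \<longrightarrow> a = b)"

lemma coproduct_separatedD:
  assumes "coproduct_separated G T" "is_coproduct G n U W i" "a \<in> tobj T W" "b \<in> tobj T W"
    "\<And>k. k < n \<Longrightarrow> tres T (U k) W (i k) a = tres T (U k) W (i k) b"
  shows "a = b"
  using assms(1)[unfolded coproduct_separated_def, rule_format, of n U W i a b] assms(2-) by blast

section \<open>Ring structure, ideals and quotients inside one Tambara functor\<close>

context tambara_functor
begin

sublocale add_fun: mackey_functor G "add_part T" by (rule mackey)
sublocale mul_fun: semi_mackey_functor G "mul_part T" by (rule semi_mackey)

abbreviation R :: "('g, 'x) gset \<Rightarrow> 'r ring" where
  "R X \<equiv> tring G T X"

lemma carrier_tring: "carrier (R X) = tobj T X"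
  by (simp add: tring_def)

lemma tres_closed:
  "\<lbrakk>finite_gset G X; finite_gset G Y; f \<in> ghom G X Y; b \<in> carrier (R Y)\<rbrakk> \<Longrightarrow> tres T X Y f b \<in> carrier (R X)"
  using add_fun.res_mem by (simp add: add_part_def carrier_tring)

lemma tadd_closed:
  "\<lbrakk>finite_gset G X; finite_gset G Y; f \<in> ghom G X Y; a \<in> carrier (R X)\<rbrakk> \<Longrightarrow> tadd T X Y f a \<in> carrier (R Y)"
  using add_fun.ind_mem by (simp add: add_part_def carrier_tring)

lemma tmul_closed:
  "\<lbrakk>finite_gset G X; finite_gset G Y; f \<in> ghom G X Y; a \<in> carrier (R X)\<rbrakk> \<Longrightarrow> tmul T X Y f a \<in> carrier (R Y)"
  using mul_fun.ind_mem by (simp add: mul_part_def carrier_tring)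

lemma tres_comp:
  "\<lbrakk>finite_gset G X; finite_gset G Y; finite_gset G Z; f \<in> ghom G X Y; g \<in> ghom G Y Z; a \<in> carrier (R Z)\<rbrakk>
     \<Longrightarrow> tres T X Z (gcomp X g f) a = tres T X Y f (tres T Y Z g a)"
  using add_fun.res_comp by (simp add: add_part_def carrier_tring)

lemma tring_ops:
  "x \<oplus>\<^bsub>R X\<^esub> y = bif_op G (add_part T) X x y" "x \<otimes>\<^bsub>R X\<^esub> y = bif_op G (mul_part T) X x y"
  "\<zero>\<^bsub>R X\<^esub> = bif_unit G (add_part T) X" "\<one>\<^bsub>R X\<^esub> = bif_unit G (mul_part T) X"
  by (simp_all add: tring_def)

lemma tres_add:
  "\<lbrakk>finite_gset G X; finite_gset G Y; f \<in> ghom G X Y; a \<in> carrier (R Y); b \<in> carrier (R Y)\<rbrakk>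
     \<Longrightarrow> tres T X Y f (a \<oplus>\<^bsub>R Y\<^esub> b) = tres T X Y f a \<oplus>\<^bsub>R X\<^esub> tres T X Y f b"
  using add_fun.res_bif_op by (simp add: carrier_tring tring_ops) (simp add: add_part_def)

lemma tres_mult:
  "\<lbrakk>finite_gset G X; finite_gset G Y; f \<in> ghom G X Y; a \<in> carrier (R Y); b \<in> carrier (R Y)\<rbrakk>
     \<Longrightarrow> tres T X Y f (a \<otimes>\<^bsub>R Y\<^esub> b) = tres T X Y f a \<otimes>\<^bsub>R X\<^esub> tres T X Y f b"
  using mul_fun.res_bif_op by (simp add: carrier_tring tring_ops) (simp add: mul_part_def)

lemma tres_zero:
  "\<lbrakk>finite_gset G X; finite_gset G Y; f \<in> ghom G X Y\<rbrakk> \<Longrightarrow> tres T X Y f \<zero>\<^bsub>R Y\<^esub> = \<zero>\<^bsub>R X\<^esub>"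
  using add_fun.res_bif_unit by (simp add: tring_ops) (simp add: add_part_def)

lemma tadd_add:
  "\<lbrakk>finite_gset G X; finite_gset G Y; f \<in> ghom G X Y; a \<in> carrier (R X); b \<in> carrier (R X)\<rbrakk>
     \<Longrightarrow> tadd T X Y f (a \<oplus>\<^bsub>R X\<^esub> b) = tadd T X Y f a \<oplus>\<^bsub>R Y\<^esub> tadd T X Y f b"
  using add_fun.ind_bif_op by (simp add: carrier_tring tring_ops) (simp add: add_part_def)

lemma tadd_fold:
  assumes "fold_map 2 i G W X p" "c \<in> carrier (R W)"
  shows "tadd T W X p c = tres T X W (i 0) c \<oplus>\<^bsub>R X\<^esub> tres T X W (i 1) c"
  using assms add_fun.bif_op_eq by (simp add: carrier_tring tring_ops) (simp add: add_part_def)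

lemma tmul_coproduct:
  assumes "is_coproduct G 2 V Z j" "finite_gset G P" "\<rho> \<in> ghom G Z P" "e \<in> carrier (R Z)"
  shows "tmul T Z P \<rho> e = tmul T (V 0) P (gcomp (V 0) \<rho> (j 0)) (tres T (V 0) Z (j 0) e)
    \<otimes>\<^bsub>R P\<^esub> tmul T (V 1) P (gcomp (V 1) \<rho> (j 1)) (tres T (V 1) Z (j 1) e)"
  using assms mul_fun.ind_coproduct by (simp add: carrier_tring tring_ops) (simp add: mul_part_def)

lemma tcoproduct_ext:
  assumes "is_coproduct G n U W i" "a \<in> carrier (R W)" "b \<in> carrier (R W)"
    "\<And>k. k < n \<Longrightarrow> tres T (U k) W (i k) a = tres T (U k) W (i k) b"
  shows "a = b"
  using assms add_fun.coproduct_ext[OF assms(1)] by (simp add: carrier_tring add_part_def)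

lemma tcoproduct_lift:
  assumes "is_coproduct G n U W i" "\<And>k. k < n \<Longrightarrow> a k \<in> carrier (R (U k))"
  obtains c where "c \<in> carrier (R W)" "\<And>k. k < n \<Longrightarrow> tres T (U k) W (i k) c = a k"
  using assms add_fun.coproduct_lift[OF assms(1), of a] by (auto simp: carrier_tring add_part_def)

text \<open>Base change for two injections: an injection is a monomorphism, so its pull-back along
  itself is the identity, while two different summands meet in the empty G-set, and induction from
  there gives zero.\<close>

lemma tres_tadd_coproduct:
  assumes W: "is_coproduct G n U W i" and j: "j < n" and k: "k < n" and a: "a \<in> carrier (R (U k))"
  shows "tres T (U j) W (i j) (tadd T (U k) W (i k) a) = (if j = k then a else \<zero>\<^bsub>R (U j)\<^esub>)"
proof -
  note D = is_coproductD[OF W]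
  show ?thesis
  proof (cases "j = k")
    case True
    have "is_pullback G (U k) W (U k) (U k) (i k) (i k) (gid (U k)) (gid (U k))"
      using D k coproduct_inj(2)[OF W k _ k]
      by (intro is_pullbackI) (auto simp: gid_ghom, auto simp: gid_def)
    from add_fun.pullback[OF this, of a] show ?thesis
      using True a D k add_fun.res_id[of "U k" a] add_fun.ind_id[of "U k" a]
      by (simp add: carrier_tring add_part_def)
  next
    case False
    obtain E c where E: "finite_gset G E" "pts E = {}" "c \<in> obj (add_part T) E"
      and unit: "bif_unit G (add_part T) (U j) = ind (add_part T) E (U j) (\<lambda>_. undefined) c"
      by (rule add_fun.bif_unit_repr[OF D(2)[OF j]])
    have "is_pullback G (U k) W E (U j) (i k) (i j) (\<lambda>_. undefined) (\<lambda>_. undefined)"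
      using D j k E False coproduct_inj(1)[OF W k _ j]
      by (intro is_pullbackI) (auto simp: ghom_empty)
    from add_fun.pullback[OF this, of a]
    have "tres T (U j) W (i j) (tadd T (U k) W (i k) a)
        = tadd T E (U j) (\<lambda>_. undefined) (tres T E (U k) (\<lambda>_. undefined) a)"
      using a by (simp add: carrier_tring add_part_def)
    moreover have "tres T E (U k) (\<lambda>_. undefined) a = c"
      using add_fun.empty_obj[OF E(1,2)] E(3) tres_closed[OF E(1) D(2)[OF k] ghom_empty[OF E(2)] a]
      by (metis (no_types, lifting) add_part_def bifunctor.select_convs(1) carrier_tring singletonD)
    ultimately show ?thesis using False unit by (simp add: tring_ops) (simp add: add_part_def)
  qed
qed

lemma ideal_ring:
  "tambara_ideal G T I \<Longrightarrow> finite_gset G X \<Longrightarrow> ideal (I X) (R X)"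
  by (simp add: tambara_ideal_def)

text \<open>The ring axioms are read off from the locale \<open>ideal\<close>, which contains them;
  commutativity of the product is \<open>bif_op_comm\<close>.\<close>

lemma tring_cring:
  assumes I: "tambara_ideal G T I" and X: "finite_gset G X"
  shows "cring (R X)"
proof -
  interpret ideal "I X" "R X" by (rule ideal_ring[OF I X])
  have "comm_monoid_axioms (R X)"
    using mul_fun.bif_op_comm[OF X]
    by (simp add: comm_monoid_axioms_def carrier_tring tring_ops) (simp add: mul_part_def)
  thus ?thesis by (intro cring.intro ring_axioms comm_monoid.intro monoid_axioms)
qed

lemma ideal_closed:
  assumes I: "tambara_ideal G T I" and "finite_gset G X" "finite_gset G Y" "f \<in> ghom G X Y"
  shows "b \<in> I Y \<Longrightarrow> tres T X Y f b \<in> I X" "a \<in> I X \<Longrightarrow> tadd T X Y f a \<in> I Y"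
    "a \<in> I X \<Longrightarrow> \<exists>d\<in>I Y. tmul T X Y f a = tmul T X Y f \<zero>\<^bsub>R X\<^esub> \<oplus>\<^bsub>R Y\<^esub> d"
proof -
  show "b \<in> I Y \<Longrightarrow> tres T X Y f b \<in> I X" "a \<in> I X \<Longrightarrow> tadd T X Y f a \<in> I Y"
    using assms unfolding tambara_ideal_def by blast+
  assume "a \<in> I X"
  hence "tmul T X Y f a \<in> tmul T X Y f \<zero>\<^bsub>R X\<^esub> <+\<^bsub>R Y\<^esub> I Y"
    using assms unfolding tambara_ideal_def by blast
  thus "\<exists>d\<in>I Y. tmul T X Y f a = tmul T X Y f \<zero>\<^bsub>R X\<^esub> \<oplus>\<^bsub>R Y\<^esub> d"
    by (auto simp: a_l_coset_def')
qed

lemma ideal_carrier: "tambara_ideal G T I \<Longrightarrow> finite_gset G X \<Longrightarrow> a \<in> I X \<Longrightarrow> a \<in> carrier (R X)"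
  by (rule ideal.Icarr[OF ideal_ring])

text \<open>\<open>a\<close> is the sum of the elements induced from its restrictions to the
  summands, and each of these lies in \<open>I W\<close>. This yields both separatedness of the
  quotient and membership of pairs in an ideal over two copies of \<open>X\<close>.\<close>

lemma ideal_coproduct:
  assumes I: "tambara_ideal G T I" and W: "is_coproduct G n U W i" and a: "a \<in> carrier (R W)"
    and aI: "\<And>k. k < n \<Longrightarrow> tres T (U k) W (i k) a \<in> I (U k)"
  shows "a \<in> I W"
proof -
  note D = is_coproductD[OF W]
  interpret W: ideal "I W" "R W" by (rule ideal_ring[OF I D(1)])
  \<comment> \<open>\<open>s\<close> is the \<open>m\<close>-th partial sum: it agrees with
    \<open>a\<close> on the first \<open>m\<close> summands and vanishes on the others. At
    \<open>m = n\<close> it is \<open>a\<close> itself.\<close>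
  have "\<exists>s\<in>I W. \<forall>k<n. tres T (U k) W (i k) s
      = (if k < m then tres T (U k) W (i k) a else \<zero>\<^bsub>R (U k)\<^esub>)" if "m \<le> n" for m
    using that
  proof (induction m)
    case 0
    thus ?case using D by (intro bexI[of _ "\<zero>\<^bsub>R W\<^esub>"]) (auto simp: tres_zero)
  next
    case (Suc m)
    then obtain s where s: "s \<in> I W" "\<And>k. k < n \<Longrightarrow> tres T (U k) W (i k) s
      = (if k < m then tres T (U k) W (i k) a else \<zero>\<^bsub>R (U k)\<^esub>)" by auto
    have m: "m < n" using Suc by simp
    let ?t = "tadd T (U m) W (i m) (tres T (U m) W (i m) a)"
    have t: "?t \<in> I W" using ideal_closed(2)[OF I D(2)[OF m] D(1) D(3)[OF m] aI[OF m]] .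
    have "tres T (U k) W (i k) (s \<oplus>\<^bsub>R W\<^esub> ?t)
        = (if k < Suc m then tres T (U k) W (i k) a else \<zero>\<^bsub>R (U k)\<^esub>)" if k: "k < n" for k
    proof -
      interpret K: cring "R (U k)" by (rule tring_cring[OF I D(2)[OF k]])
      have "tres T (U k) W (i k) (s \<oplus>\<^bsub>R W\<^esub> ?t) =
          (if k < m then tres T (U k) W (i k) a else \<zero>\<^bsub>R (U k)\<^esub>) \<oplus>\<^bsub>R (U k)\<^esub>
          (if k = m then tres T (U m) W (i m) a else \<zero>\<^bsub>R (U k)\<^esub>)"
        using k m D a s t
        by (subst tres_add) (simp_all add: tres_tadd_coproduct[OF W] tres_closed W.Icarr)
      moreover have "tres T (U k) W (i k) a \<in> carrier (R (U k))"
        by (rule tres_closed[OF D(2)[OF k] D(1) D(3)[OF k] a])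
      note K.l_zero[OF this] K.r_zero[OF this]
      ultimately show ?thesis by (cases "k = m") (simp_all add: less_Suc_eq)
    qed
    thus ?case using s(1) t by (intro bexI[of _ "s \<oplus>\<^bsub>R W\<^esub> ?t"]) auto
  qed
  from this[of n] obtain s where "s \<in> I W" "\<And>k. k < n \<Longrightarrow> tres T (U k) W (i k) s = tres T (U k) W (i k) a"
    by auto
  thus ?thesis using tcoproduct_ext[OF W _ a] by (metis W.Icarr)
qed

text \<open>A point of \<open>P\<close> labels every point of a fibre of \<open>f\<close> with one
  of the two copies in \<open>W\<close>, that is, with one of the two summands. The claim has the
  shape that \<open>coset_Union\<close> expects.\<close>

lemma tmul_add_ideal:
  assumes I: "tambara_ideal G T I" and X: "finite_gset G X" and Y: "finite_gset G Y" and f: "f \<in> ghom G X Y"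
    and a: "a \<in> carrier (R X)" and d: "d \<in> I X"
  shows "\<exists>\<delta>\<in>I Y. tmul T X Y f (d \<oplus>\<^bsub>R X\<^esub> a) = \<delta> \<oplus>\<^bsub>R Y\<^esub> tmul T X Y f a"
proof -
  interpret X: cring "R X" by (rule tring_cring[OF I X])
  interpret Y: cring "R Y" by (rule tring_cring[OF I Y])
  obtain W i p where p: "fold_map 2 i G W X p" by (rule fold_map_exists[OF X])
  note W = fold_mapD[OF p]
  have lift: "\<exists>c\<in>carrier (R W). tres T X W (i 0) c = x \<and> tres T X W (i 1) c = a" if x: "x \<in> carrier (R X)" for x
  proof -
    obtain c where c: "c \<in> carrier (R W)" "\<And>k. k < 2 \<Longrightarrow> tres T X W (i k) c = (if k = 0 then x else a)"
      by (rule tcoproduct_lift[OF W(1), of "\<lambda>k. if k = 0 then x else a"]) (use x a in auto)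
    thus ?thesis using c(2)[of 0] c(2)[of 1] by (intro bexI[of _ c]) simp_all
  qed
  obtain P Z \<pi> \<rho> \<epsilon> where ex: "is_exponential G W X Y P Z p f \<pi> \<rho> \<epsilon>"
    and P: "finite_gset G P" and Z: "finite_gset G Z" and \<pi>: "\<pi> \<in> ghom G P Y" and \<rho>: "\<rho> \<in> ghom G Z P"
    and \<epsilon>: "\<epsilon> \<in> ghom G Z W"
    by (rule exponential_exists[OF W(3) X Y W(2) f])
  interpret P: cring "R P" by (rule tring_cring[OF I P])
  interpret PI: ideal "I P" "R P" by (rule ideal_ring[OF I P])
  \<comment> \<open>\<open>Z\<close> splits according to the copy hit by the evaluated section:
    \<open>V 0\<close> collects the points labelled with the first summand, \<open>V 1\<close> those
    labelled with the second.\<close>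
  obtain V j l where V: "is_coproduct G 2 V Z j"
    and l: "\<And>k. k < 2 \<Longrightarrow> l k \<in> ghom G (V k) X"
    and jl: "\<And>k. k < 2 \<Longrightarrow> gcomp (V k) \<epsilon> (j k) = gcomp (V k) (i k) (l k)"
    by (rule coproduct_base_change[OF W(1) Z \<epsilon>]) blast
  note VD = is_coproductD[OF V]
  let ?\<rho> = "\<lambda>k. gcomp (V k) \<rho> (j k)"
  have \<rho>k: "?\<rho> k \<in> ghom G (V k) P" if "k < 2" for k
    using gcomp_ghom[OF VD(2,3)[OF that] \<rho>] .
  define N where "N = tmul T (V 1) P (?\<rho> 1) (tres T (V 1) X (l 1) a)"
  have N: "N \<in> carrier (R P)"
    using VD \<rho>k l X P a unfolding N_def by (simp add: tmul_closed tres_closed)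
  define \<nu> where "\<nu> = (\<lambda>x. tmul T (V 0) P (?\<rho> 0) (tres T (V 0) X (l 0) x))"
  have \<nu>: "\<nu> x \<in> carrier (R P)" if "x \<in> carrier (R X)" for x
    using VD \<rho>k l X P that unfolding \<nu>_def by (simp add: tmul_closed tres_closed)
  \<comment> \<open>The norm along \<open>\<rho>\<close> of the pulled-back pair (x, a) is a product
    over the two parts of \<open>Z\<close>, and only the factor from \<open>V 0\<close> depends on
    \<open>x\<close>.\<close>
  have norm: "tmul T X Y f (x \<oplus>\<^bsub>R X\<^esub> a) = tadd T P Y \<pi> (\<nu> x \<otimes>\<^bsub>R P\<^esub> N)" if x: "x \<in> carrier (R X)" for x
  proof -
    obtain c where c: "c \<in> carrier (R W)" "tres T X W (i 0) c = x" "tres T X W (i 1) c = a"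
      using lift[OF x] by blast
    have "tres T (V k) Z (j k) (tres T Z W \<epsilon> c) = tres T (V k) X (l k) (tres T X W (i k) c)" if k: "k < 2" for k
      using tres_comp[OF VD(2)[OF k] Z W(3) VD(3)[OF k] \<epsilon> c(1)]
        tres_comp[OF VD(2)[OF k] X W(3) l[OF k] W(5)[OF k] c(1)] jl[OF k] by simp
    from this[of 0] this[of 1]
    have "tmul T Z P \<rho> (tres T Z W \<epsilon> c) = \<nu> x \<otimes>\<^bsub>R P\<^esub> N"
      using tmul_coproduct[OF V P \<rho> tres_closed[OF Z W(3) \<epsilon> c(1)]] c by (simp add: N_def \<nu>_def)
    moreover have "tadd T W X p c = x \<oplus>\<^bsub>R X\<^esub> a" using tadd_fold[OF p c(1)] c by simp
    ultimately show ?thesis using exponential[OF ex, of c] c(1) by (simp add: carrier_tring)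
  qed
  have dc: "d \<in> carrier (R X)" by (rule ideal_carrier[OF I X d])
  \<comment> \<open>The norm clause of the ideal is applied to the map from \<open>V 0\<close> to
    \<open>P\<close>; \<open>pos2\<close> selects the index 0. Its constant term is the value of
    \<open>\<nu>\<close> at zero.\<close>
  have "tres T (V 0) X (l 0) d \<in> I (V 0)" using ideal_closed(1)[OF I VD(2) X l d] by simp
  then obtain \<delta> where \<delta>: "\<delta> \<in> I P" "\<nu> d = tmul T (V 0) P (?\<rho> 0) \<zero>\<^bsub>R (V 0)\<^esub> \<oplus>\<^bsub>R P\<^esub> \<delta>"
    using ideal_closed(3)[OF I VD(2)[OF pos2] P \<rho>k[OF pos2]] unfolding \<nu>_def by blast
  moreover have "\<nu> \<zero>\<^bsub>R X\<^esub> = tmul T (V 0) P (?\<rho> 0) \<zero>\<^bsub>R (V 0)\<^esub>"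
    using tres_zero[OF VD(2) X l] by (simp add: \<nu>_def)
  ultimately have "\<nu> d = \<nu> \<zero>\<^bsub>R X\<^esub> \<oplus>\<^bsub>R P\<^esub> \<delta>" by simp
  hence "\<nu> d \<otimes>\<^bsub>R P\<^esub> N = (\<delta> \<otimes>\<^bsub>R P\<^esub> N) \<oplus>\<^bsub>R P\<^esub> (\<nu> \<zero>\<^bsub>R X\<^esub> \<otimes>\<^bsub>R P\<^esub> N)"
    using N \<nu>[OF X.zero_closed] PI.Icarr[OF \<delta>(1)] by (simp add: P.l_distr P.add.m_comm)
  moreover have \<delta>N: "\<delta> \<otimes>\<^bsub>R P\<^esub> N \<in> I P" using \<delta>(1) N by (rule PI.I_r_closed)
  \<comment> \<open>\<open>norm\<close> is used twice, at \<open>d\<close> and at zero; the latter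
    turns the second summand back into the norm of \<open>a\<close>.\<close>
  ultimately have "tmul T X Y f (d \<oplus>\<^bsub>R X\<^esub> a) = tadd T P Y \<pi> (\<delta> \<otimes>\<^bsub>R P\<^esub> N) \<oplus>\<^bsub>R Y\<^esub> tmul T X Y f (\<zero>\<^bsub>R X\<^esub> \<oplus>\<^bsub>R X\<^esub> a)"
    using norm[OF dc] norm[OF X.zero_closed] N \<nu>
    by (simp add: tadd_add[OF P Y \<pi>] PI.Icarr)
  thus ?thesis using ideal_closed(2)[OF I P Y \<pi> \<delta>N] a by auto
qed

lemma tambara_quot_obj: "tobj (tambara_quot G T I) X = (\<lambda>a. I X +>\<^bsub>R X\<^esub> a) ` carrier (R X)"
  by (auto simp: tambara_quot_def FactRing_def A_RCOSETS_def')

text \<open>All cosets in the union coincide once \<open>F\<close> sends the coset of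
  \<open>a\<close> into one coset. \<open>Fa\<close> is phrased for a single \<open>a\<close> and
  without additivity so that it covers \<open>tmul\<close> as well as \<open>tres\<close> and
  \<open>tadd\<close>.\<close>

lemma coset_Union:
  assumes I: "tambara_ideal G T I" and X: "finite_gset G X" and Y: "finite_gset G Y"
    and F: "\<And>x. x \<in> carrier (R X) \<Longrightarrow> F x \<in> carrier (R Y)"
    and Fa: "\<And>h. h \<in> I X \<Longrightarrow> \<exists>\<delta>\<in>I Y. F (h \<oplus>\<^bsub>R X\<^esub> a) = \<delta> \<oplus>\<^bsub>R Y\<^esub> F a"
    and a: "a \<in> carrier (R X)"
  shows "(\<Union>x\<in>I X +>\<^bsub>R X\<^esub> a. I Y +>\<^bsub>R Y\<^esub> F x) = I Y +>\<^bsub>R Y\<^esub> F a"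
proof -
  interpret X: ideal "I X" "R X" by (rule ideal_ring[OF I X])
  interpret Y: ideal "I Y" "R Y" by (rule ideal_ring[OF I Y])
  have "I Y +>\<^bsub>R Y\<^esub> F x = I Y +>\<^bsub>R Y\<^esub> F a" if x: "x \<in> I X +>\<^bsub>R X\<^esub> a" for x
  proof -
    obtain h where h: "h \<in> I X" "x = h \<oplus>\<^bsub>R X\<^esub> a" using x by (auto simp: a_r_coset_def')
    have "F x \<in> I Y +>\<^bsub>R Y\<^esub> F a" using Fa[OF h(1)] h(2) by (auto simp: a_r_coset_def')
    thus ?thesis using Y.a_repr_independence' F[OF a] by blast
  qed
  moreover have "a \<in> I X +>\<^bsub>R X\<^esub> a" using X.a_rcos_self a by blast
  ultimately show ?thesis by blast
qed

lemma tambara_quot_map: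
  assumes I: "tambara_ideal G T I"
  shows "tambara_map G T (tambara_quot G T I) (\<lambda>X a. I X +>\<^bsub>R X\<^esub> a)"
proof (rule tambara_mapI; unfold carrier_tring[symmetric])
  fix X Y :: "('g, 'x) gset" and f b
  assume X: "finite_gset G X" and Y: "finite_gset G Y" and f: "f \<in> ghom G X Y" and b: "b \<in> carrier (R Y)"
  have "(\<Union>x\<in>I Y +>\<^bsub>R Y\<^esub> b. I X +>\<^bsub>R X\<^esub> tres T X Y f x) = I X +>\<^bsub>R X\<^esub> tres T X Y f b"
    by (rule coset_Union[OF I Y X])
      (use b tres_closed[OF X Y f] tres_add[OF X Y f] ideal_closed(1)[OF I X Y f] ideal_carrier[OF I Y] in auto)
  thus "I X +>\<^bsub>R X\<^esub> tres T X Y f b = tres (tambara_quot G T I) X Y f (I Y +>\<^bsub>R Y\<^esub> b)"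
    by (simp add: tambara_quot_def)
next
  fix X Y :: "('g, 'x) gset" and f a
  assume X: "finite_gset G X" and Y: "finite_gset G Y" and f: "f \<in> ghom G X Y" and a: "a \<in> carrier (R X)"
  have "(\<Union>x\<in>I X +>\<^bsub>R X\<^esub> a. I Y +>\<^bsub>R Y\<^esub> tadd T X Y f x) = I Y +>\<^bsub>R Y\<^esub> tadd T X Y f a"
    by (rule coset_Union[OF I X Y])
      (use a tadd_closed[OF X Y f] tadd_add[OF X Y f] ideal_closed(2)[OF I X Y f] ideal_carrier[OF I X] in auto)
  thus "I Y +>\<^bsub>R Y\<^esub> tadd T X Y f a = tadd (tambara_quot G T I) X Y f (I X +>\<^bsub>R X\<^esub> a)"
    by (simp add: tambara_quot_def)
  have "(\<Union>x\<in>I X +>\<^bsub>R X\<^esub> a. I Y +>\<^bsub>R Y\<^esub> tmul T X Y f x) = I Y +>\<^bsub>R Y\<^esub> tmul T X Y f a"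
    by (rule coset_Union[OF I X Y])
      (use a tmul_closed[OF X Y f] tmul_add_ideal[OF I X Y f a] in auto)
  thus "I Y +>\<^bsub>R Y\<^esub> tmul T X Y f a = tmul (tambara_quot G T I) X Y f (I X +>\<^bsub>R X\<^esub> a)"
    by (simp add: tambara_quot_def)
qed (auto simp: tambara_quot_obj)

text \<open>If two cosets agree on every summand, the difference of representatives restricts into
  the ideal everywhere, so \<open>ideal_coproduct\<close> applies to it.\<close>

lemma tambara_quot_separated:
  assumes I: "tambara_ideal G T I"
  shows "coproduct_separated G (tambara_quot G T I)"
  unfolding coproduct_separated_def
proof (intro allI impI; elim conjE)
  fix n and U :: "nat \<Rightarrow> ('g, 'x) gset" and W i A B
  let ?Q = "tambara_quot G T I"
  assume W: "is_coproduct G n U W i" and "A \<in> tobj ?Q W" and "B \<in> tobj ?Q W"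
    and eq: "\<forall>k<n. tres ?Q (U k) W (i k) A = tres ?Q (U k) W (i k) B"
  then obtain a b where a: "a \<in> carrier (R W)" "A = I W +>\<^bsub>R W\<^esub> a" and b: "b \<in> carrier (R W)" "B = I W +>\<^bsub>R W\<^esub> b"
    by (auto simp: tambara_quot_obj)
  note D = is_coproductD[OF W]
  interpret W: cring "R W" by (rule tring_cring[OF I D(1)])
  have "a \<ominus>\<^bsub>R W\<^esub> b \<in> I W"
  proof (rule ideal_coproduct[OF I W])
    fix k assume k: "k < n"
    note res = tres_closed[OF D(2)[OF k] D(1) D(3)[OF k]]
    interpret K: cring "R (U k)" by (rule tring_cring[OF I D(2)[OF k]])
    have "I (U k) +>\<^bsub>R (U k)\<^esub> tres T (U k) W (i k) a = I (U k) +>\<^bsub>R (U k)\<^esub> tres T (U k) W (i k) b"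
      using eq k a b tambara_mapD(2)[OF tambara_quot_map[OF I] D(2)[OF k] D(1) D(3)[OF k]]
      by (simp add: carrier_tring)
    hence "tres T (U k) W (i k) a \<ominus>\<^bsub>R (U k)\<^esub> tres T (U k) W (i k) b \<in> I (U k)"
      using K.quotient_eq_iff_same_a_r_cos[OF ideal_ring[OF I D(2)[OF k]]] res a b by blast
    \<comment> \<open>Compatibility of restriction with differences is derived from additivity by
      adding the restriction of \<open>b\<close> back.\<close>
    moreover have "tres T (U k) W (i k) (a \<ominus>\<^bsub>R W\<^esub> b) \<oplus>\<^bsub>R (U k)\<^esub> tres T (U k) W (i k) b = tres T (U k) W (i k) a"
      using a b by (subst tres_add[symmetric])
        (simp_all add: D k W.minus_eq W.add.m_assoc W.l_neg)
    hence "tres T (U k) W (i k) (a \<ominus>\<^bsub>R W\<^esub> b) = tres T (U k) W (i k) a \<ominus>\<^bsub>R (U k)\<^esub> tres T (U k) W (i k) b"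
      using a b res[of a] res[of b] res[of "a \<ominus>\<^bsub>R W\<^esub> b"]
      by (metis K.add.inv_solve_right K.minus_eq W.minus_closed)
    ultimately show "tres T (U k) W (i k) (a \<ominus>\<^bsub>R W\<^esub> b) \<in> I (U k)" by simp
  qed (use a b in simp)
  thus "A = B" using W.quotient_eq_iff_same_a_r_cos[OF ideal_ring[OF I D(1)]] a b by blast
qed

lemma tambara_image:
  assumes \<phi>: "tambara_map G T S \<phi>"
    and surj: "\<And>X. finite_gset G X \<Longrightarrow> tobj S X \<subseteq> \<phi> X ` tobj T X"
    and sep: "coproduct_separated G S"
  shows "tambara_functor G S"
proof (rule tambara_functor.intro)
  note \<phi>D = tambara_mapD[OF \<phi>]
  have add: "semi_mackey_functor G (add_part S)"
    by (rule semi_mackey_image[OF add_fun.semi_mackey_functor_axioms])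
      (use \<phi> surj coproduct_separatedD[OF sep] in \<open>auto simp: tambara_map_def add_part_def\<close>)
  show "semi_mackey_functor G (mul_part S)"
    by (rule semi_mackey_image[OF mul_fun.semi_mackey_functor_axioms])
      (use \<phi> surj coproduct_separatedD[OF sep] in \<open>auto simp: tambara_map_def mul_part_def\<close>)
  show "mackey_functor G (add_part S)"
    by (rule mackey_image[OF mackey add]) (use \<phi> surj in \<open>auto simp: tambara_map_def add_part_def\<close>)
  fix A X Y P Z :: "('g, 'x) gset" and p f \<pi> \<rho> \<epsilon> a
  assume ex: "is_exponential G A X Y P Z p f \<pi> \<rho> \<epsilon>" and "a \<in> tobj S A"
  note D = is_exponentialD[OF ex]
  obtain a' where a': "a' \<in> tobj T A" "a = \<phi> A a'" using surj[OF D(1)] \<open>a \<in> tobj S A\<close> by blast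
  note cl = tres_closed[unfolded carrier_tring] tadd_closed[unfolded carrier_tring] tmul_closed[unfolded carrier_tring]
  have "tmul S X Y f (tadd S A X p a) = \<phi> Y (tmul T X Y f (tadd T A X p a'))"
    using D a' by (simp add: \<phi>D cl)
  also have "\<dots> = \<phi> Y (tadd T P Y \<pi> (tmul T Z P \<rho> (tres T Z A \<epsilon> a')))"
    using exponential[OF ex a'(1)] by simp
  also have "\<dots> = tadd S P Y \<pi> (tmul S Z P \<rho> (tres S Z A \<epsilon> a))"
    using D a' by (simp add: \<phi>D cl)
  finally show "tmul S X Y f (tadd S A X p a) = tadd S P Y \<pi> (tmul S Z P \<rho> (tres S Z A \<epsilon> a))" .
qed

lemma tambara_quot_functor:
  assumes I: "tambara_ideal G T I"
  shows "tambara_functor G (tambara_quot G T I)"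
  by (rule tambara_image[OF tambara_quot_map[OF I] _ tambara_quot_separated[OF I]])
    (simp add: tambara_quot_obj carrier_tring)

end

text \<open>Sums, products and the unit come from the structure maps, so a natural family between
  Tambara functors consists of ring homomorphisms.\<close>

lemma tambara_homI:
  fixes T :: "('g, 'x::infinite, 'r) tambara" and S :: "('g, 'x, 's) tambara"
  assumes T: "tambara_functor G T" and S: "tambara_functor G S" and \<phi>: "tambara_map G T S \<phi>"
  shows "tambara_hom G T S \<phi>"
proof -
  interpret T: tambara_functor G T by fact
  interpret S: tambara_functor G S by fact
  have add: "bifunctor_map G (add_part T) (add_part S) \<phi>" and mul: "bifunctor_map G (mul_part T) (mul_part S) \<phi>"
    using \<phi> by (auto simp: tambara_map_def)
  have "\<phi> X \<in> ring_hom (tring G T X) (tring G S X)" if X: "finite_gset G X" for X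
    using bifunctor_map_op[OF T.add_fun.semi_mackey_functor_axioms S.add_fun.semi_mackey_functor_axioms add X]
      bifunctor_map_op[OF T.semi_mackey S.semi_mackey mul X]
      bifunctor_map_unit[OF T.semi_mackey S.semi_mackey mul X] tambara_mapD(1)[OF \<phi> X]
    by (intro ring_hom_memI) (simp_all add: T.carrier_tring S.carrier_tring T.tring_ops S.tring_ops, simp_all add: add_part_def mul_part_def)
  thus ?thesis using T S tambara_mapD[OF \<phi>] by (auto simp: tambara_hom_def)
qed

lemma tambara_isoI:
  fixes T :: "('g, 'x::infinite, 'r) tambara" and S :: "('g, 'x, 's) tambara"
  assumes T: "tambara_functor G T" and S: "tambara_functor G S" and \<phi>: "tambara_map G T S \<phi>"
    and bij: "\<And>X. finite_gset G X \<Longrightarrow> bij_betw (\<phi> X) (tobj T X) (tobj S X)"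
  shows "tambara_iso G T S \<phi>"
proof -
  interpret T: tambara_functor G T by fact
  interpret S: tambara_functor G S by fact
  note cl = T.tres_closed T.tadd_closed T.tmul_closed
  note \<phi>D = tambara_mapD[OF \<phi>]
  define \<psi> where "\<psi> = (\<lambda>X. inv_into (tobj T X) (\<phi> X))"
  have \<psi>\<phi>: "\<psi> X (\<phi> X a) = a" if "finite_gset G X" "a \<in> tobj T X" for X a
    using bij[OF that(1)] that(2) by (simp add: \<psi>_def bij_betw_def)
  have \<phi>\<psi>: "\<phi> X (\<psi> X b) = b" "\<psi> X b \<in> tobj T X" if "finite_gset G X" "b \<in> tobj S X" for X b
    using bij[OF that(1)] that(2) by (auto simp: \<psi>_def bij_betw_def f_inv_into_f inv_into_into)
  have "tambara_map G S T \<psi>"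
  proof (rule tambara_mapI)
    fix X Y :: "('g, 'x) gset" and f b
    assume *: "finite_gset G X" "finite_gset G Y" "f \<in> ghom G X Y" "b \<in> tobj S Y"
    show "\<psi> X (tres S X Y f b) = tres T X Y f (\<psi> Y b)"
      using * \<phi>\<psi>[OF *(2,4)] \<psi>\<phi>[OF *(1)] \<phi>D(2)[OF *(1-3)] cl[unfolded T.carrier_tring] by metis
  next
    fix X Y :: "('g, 'x) gset" and f a
    assume *: "finite_gset G X" "finite_gset G Y" "f \<in> ghom G X Y" "a \<in> tobj S X"
    show "\<psi> Y (tadd S X Y f a) = tadd T X Y f (\<psi> X a)"
      using * \<phi>\<psi>[OF *(1,4)] \<psi>\<phi>[OF *(2)] \<phi>D(3)[OF *(1-3)] cl[unfolded T.carrier_tring] by metis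
    show "\<psi> Y (tmul S X Y f a) = tmul T X Y f (\<psi> X a)"
      using * \<phi>\<psi>[OF *(1,4)] \<psi>\<phi>[OF *(2)] \<phi>D(4)[OF *(1-3)] cl[unfolded T.carrier_tring] by metis
  qed (use \<phi>\<psi> in auto)
  thus ?thesis
    using tambara_homI[OF T S \<phi>] tambara_homI[OF S T, of \<psi>] \<psi>\<phi> \<phi>\<psi>
    unfolding tambara_iso_def by blast
qed

text \<open>The factorisation property of a surjection: \<open>\<theta>\<close> is
  \<open>\<phi>\<close> after \<open>q\<close>, and naturality of \<open>\<phi>\<close> is tested on
  elements of the form \<open>q X a\<close>.\<close>

lemma tambara_map_factor:
  assumes q: "tambara_map G T S q" and \<theta>: "tambara_map G T S' \<theta>"
    and surj: "\<And>X. finite_gset G X \<Longrightarrow> tobj S X = q X ` tobj T X"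
    and \<phi>: "\<And>X a. \<lbrakk>finite_gset G X; a \<in> tobj T X\<rbrakk> \<Longrightarrow> \<phi> X (q X a) = \<theta> X a"
    and T: "tambara_functor G T"
  shows "tambara_map G S S' \<phi>"
proof -
  interpret T: tambara_functor G T by fact
  note cl = T.tres_closed[unfolded T.carrier_tring] T.tadd_closed[unfolded T.carrier_tring]
    T.tmul_closed[unfolded T.carrier_tring]
  note qD = tambara_mapD[OF q] and \<theta>D = tambara_mapD[OF \<theta>]
  show ?thesis
    by (rule tambara_mapI) (auto simp: surj \<phi> \<theta>D(1) qD(2-4)[symmetric] \<theta>D(2-4)[symmetric] cl)
qed

lemma tambara_prod_map:
  assumes "\<And>i. i \<in> J \<Longrightarrow> tambara_map G T (S i) (\<phi> i)"
  shows "tambara_map G T (tambara_prod J S) (\<lambda>X a. \<lambda>i\<in>J. \<phi> i X a)"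
  by (rule tambara_mapI) (use tambara_mapD[OF assms] in \<open>auto simp: tambara_prod_def fun_eq_iff\<close>)

lemma tambara_prod_separated:
  assumes sep: "\<And>i. i \<in> J \<Longrightarrow> coproduct_separated G (S i)"
  shows "coproduct_separated G (tambara_prod J S)"
  unfolding coproduct_separated_def
proof (intro allI impI; elim conjE)
  fix n U W i a b
  assume W: "is_coproduct G n U W i" and a: "a \<in> tobj (tambara_prod J S) W" and b: "b \<in> tobj (tambara_prod J S) W"
    and eq: "\<forall>k<n. tres (tambara_prod J S) (U k) W (i k) a = tres (tambara_prod J S) (U k) W (i k) b"
  have "a s = b s" if s: "s \<in> J" for s
  proof -
    have "tres (S s) (U k) W (i k) (a s) = tres (S s) (U k) W (i k) (b s)" if "k < n" for k
      using fun_cong[of _ _ s, OF eq[rule_format, OF that]] s by (simp add: tambara_prod_def)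
    moreover have "a s \<in> tobj (S s) W" "b s \<in> tobj (S s) W"
      using a b s by (auto simp: tambara_prod_def)
    ultimately show ?thesis using coproduct_separatedD[OF sep[OF s] W] by blast
  qed
  thus "a = b" using a b by (auto simp: tambara_prod_def intro: PiE_ext)
qed

section \<open>The Chinese remainder theorem\<close>

lemma (in ring) comaximalE:
  assumes "I <+> J = carrier R"
  obtains x y where "x \<in> I" "y \<in> J" "\<one> = x \<oplus> y"
proof -
  have "\<one> \<in> I <+> J" using assms by simp
  thus thesis using that by (auto simp: set_add_def')
qed

lemma (in cring) coprime_inter:
  assumes I: "ideal I R" and J: "ideal J R" and K: "ideal K R"
    and IK: "I <+> K = carrier R" and JK: "J <+> K = carrier R"
  shows "(I \<inter> J) <+> K = carrier R"
proof -
  interpret S: ideal "set_add R (I \<inter> J) K" R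
    by (rule add_ideals[OF i_intersect[OF I J] K])
  obtain x y where xy: "x \<in> I" "y \<in> K" "\<one> = x \<oplus> y"
    by (rule comaximalE[OF IK])
  obtain u v where uv: "u \<in> J" "v \<in> K" "\<one> = u \<oplus> v"
    by (rule comaximalE[OF JK])
  have carr: "x \<in> carrier R" "y \<in> carrier R" "u \<in> carrier R" "v \<in> carrier R"
    using xy uv ideal.Icarr I J K by metis+
  \<comment> \<open>Write \<open>1 = x + y\<close> and replace \<open>x\<close> by
    \<open>x (u + v)\<close>: the part \<open>x u\<close> lies in both ideals, the rest in
    \<open>K\<close>.\<close>
  have "x \<otimes> u \<oplus> (x \<otimes> v \<oplus> y) = x \<otimes> (u \<oplus> v) \<oplus> y"
    using carr by algebra
  hence "\<one> = x \<otimes> u \<oplus> (x \<otimes> v \<oplus> y)"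
    using carr xy(3) uv(3) by (metis r_one)
  moreover have "x \<otimes> u \<in> I \<inter> J"
    using xy uv carr ideal.I_r_closed[OF I] ideal.I_l_closed[OF J] by blast
  moreover have "x \<otimes> v \<oplus> y \<in> K"
    using xy uv carr ideal.I_l_closed[OF K] additive_subgroup.a_closed[OF ideal.axioms(1)[OF K]] by blast
  ultimately have "\<one> \<in> (I \<inter> J) <+> K" by (auto simp: set_add_def')
  thus ?thesis by (rule S.one_imp_carrier)
qed

lemma (in cring) coprime_Inter:
  assumes "finite A" "A \<noteq> {}" and "\<And>i. i \<in> A \<Longrightarrow> ideal (I i) R" and K: "ideal K R"
    and "\<And>i. i \<in> A \<Longrightarrow> I i <+> K = carrier R"
  shows "ideal (\<Inter>i\<in>A. I i) R \<and> (\<Inter>i\<in>A. I i) <+> K = carrier R"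
  using assms
proof (induction A rule: finite_ne_induct)
  case (insert j A)
  thus ?case using i_intersect coprime_inter by simp
qed simp

lemma (in cring) chinese_remainder_solution:
  assumes "finite A" "A \<noteq> {}" and "\<And>i. i \<in> A \<Longrightarrow> ideal (I i) R"
    and "\<And>i j. \<lbrakk>i \<in> A; j \<in> A; i \<noteq> j\<rbrakk> \<Longrightarrow> I i <+> I j = carrier R"
    and "\<And>i. i \<in> A \<Longrightarrow> a i \<in> carrier R"
  shows "\<exists>x\<in>carrier R. \<forall>i\<in>A. I i +> x = I i +> a i"
  using assms
proof (induction A rule: finite_ne_induct)
  case (singleton j)
  thus ?case by (intro bexI[of _ "a j"]) auto
next
  case (insert j A)
  then obtain x where x: "x \<in> carrier R" "\<And>i. i \<in> A \<Longrightarrow> I i +> x = I i +> a i"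
    by (metis (no_types, lifting) insertCI)
  have j: "ideal (I j) R" "a j \<in> carrier R" using insert.prems by auto
  have "(\<Inter>i\<in>A. I i) <+> I j = carrier R"
    using insert.hyps(3) by (intro conjunct2[OF coprime_Inter] insert.hyps insert.prems) auto
  then obtain e f where ef: "e \<in> (\<Inter>i\<in>A. I i)" "f \<in> I j" "\<one> = e \<oplus> f"
    by (rule comaximalE)
  have f: "f \<in> carrier R" using ef(2) ideal.Icarr[OF j(1)] by blast
  have e: "e \<in> carrier R"
    using ef(1) insert.prems(1) ideal.Icarr insert.hyps(2) by fastforce
  \<comment> \<open>Modulo each \<open>I i\<close> with \<open>i\<close> in \<open>A\<close>,
    \<open>e\<close> is 0 and \<open>f\<close> is 1, so the new element agrees with the old solution
    \<open>x\<close>; modulo \<open>I j\<close> the roles of \<open>e\<close> and \<open>f\<close>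
    are exchanged and it agrees with \<open>a j\<close>.\<close>
  let ?x = "f \<otimes> x \<oplus> e \<otimes> a j"
  have 1: "I i +> ?x = I i +> x" if "i \<in> A" for i
  proof -
    interpret ideal "I i" R using insert.prems that by blast
    have "(e \<oplus> f) \<otimes> x = x" using x ef(3) by (metis l_one)
    moreover have "?x = e \<otimes> (a j \<ominus> x) \<oplus> (e \<oplus> f) \<otimes> x" using e f x(1) j(2) by algebra
    ultimately have "?x = e \<otimes> (a j \<ominus> x) \<oplus> x" by simp
    moreover have "e \<otimes> (a j \<ominus> x) \<in> I i" using ef(1) that x(1) j(2) by (intro I_r_closed) auto
    ultimately have "?x \<in> I i +> x" by (auto simp: a_r_coset_def')
    thus ?thesis using a_repr_independence' x(1) by blast
  qed
  have 2: "I j +> ?x = I j +> a j"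
  proof -
    interpret ideal "I j" R by (rule j)
    have "(e \<oplus> f) \<otimes> a j = a j" using j ef(3) by (metis l_one)
    moreover have "?x = f \<otimes> (x \<ominus> a j) \<oplus> (e \<oplus> f) \<otimes> a j" using e f x(1) j(2) by algebra
    ultimately have "?x = f \<otimes> (x \<ominus> a j) \<oplus> a j" by simp
    moreover have "f \<otimes> (x \<ominus> a j) \<in> I j" using ef(2) x(1) j(2) by (intro I_r_closed) auto
    ultimately have "?x \<in> I j +> a j" by (auto simp: a_r_coset_def')
    thus ?thesis using a_repr_independence' j(2) by blast
  qed
  have "?x \<in> carrier R" using e f x(1) j(2) by simp
  moreover have "\<forall>i\<in>insert j A. I i +> ?x = I i +> a i" using 1 2 x(2) by auto
  ultimately show ?case by blast
qed

section \<open>Products of coprime ideals of a Tambara functor and the final isomorphism\<close>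

lemma iterated_prod_1: "iterated_prod op I (Suc 0) = I 1"
  by (simp add: iterated_prod_def)

lemma iterated_prod_Suc: "m \<ge> 1 \<Longrightarrow> iterated_prod op I (Suc m) = op (iterated_prod op I m) (I (Suc m))"
  by (simp add: iterated_prod_def)

text \<open>Product and intersection are compared only at finite G-sets, so they need not be equal
  as functions; being an ideal depends only on those values.\<close>

lemma tambara_ideal_cong:
  assumes "\<And>X. finite_gset G X \<Longrightarrow> I X = J X"
  shows "tambara_ideal G T I \<longleftrightarrow> tambara_ideal G T J"
  using assms unfolding tambara_ideal_def by (intro conj_cong all_cong imp_cong) simp_all

context tambara_functor
begin

lemma ideal_subset: "tambara_ideal G T I \<Longrightarrow> finite_gset G X \<Longrightarrow> I X \<subseteq> carrier (R X)"
  using ideal_carrier by blast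

lemma tambara_ideal_inter:
  assumes I: "tambara_ideal G T I" and J: "tambara_ideal G T J"
  shows "tambara_ideal G T (\<lambda>X. I X \<inter> J X)"
  unfolding tambara_ideal_def
proof (intro conjI allI impI; (elim conjE)?)
  fix X :: "('g, 'x) gset" assume X: "finite_gset G X"
  interpret X: cring "R X" by (rule tring_cring[OF I X])
  show "ideal (I X \<inter> J X) (R X)"
    using X.i_intersect ideal_ring[OF I X] ideal_ring[OF J X] .
next
  fix X Y :: "('g, 'x) gset" and f
  assume X: "finite_gset G X" and Y: "finite_gset G Y" and f: "f \<in> ghom G X Y"
  interpret X: cring "R X" by (rule tring_cring[OF I X])
  interpret Y: cring "R Y" by (rule tring_cring[OF I Y])
  note closed = ideal_closed[OF I X Y f] ideal_closed[OF J X Y f]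
  show "tres T X Y f ` (I Y \<inter> J Y) \<subseteq> I X \<inter> J X" "tadd T X Y f ` (I X \<inter> J X) \<subseteq> I Y \<inter> J Y"
    using closed by blast+
  show "tmul T X Y f ` (I X \<inter> J X) \<subseteq> tmul T X Y f \<zero>\<^bsub>R X\<^esub> <+\<^bsub>R Y\<^esub> (I Y \<inter> J Y)"
  proof safe
    fix a assume "a \<in> I X" "a \<in> J X"
    then obtain d d' where d: "d \<in> I Y" "tmul T X Y f a = tmul T X Y f \<zero>\<^bsub>R X\<^esub> \<oplus>\<^bsub>R Y\<^esub> d"
      and d': "d' \<in> J Y" "tmul T X Y f a = tmul T X Y f \<zero>\<^bsub>R X\<^esub> \<oplus>\<^bsub>R Y\<^esub> d'"
      using closed(3,6) by metis
    \<comment> \<open>Both are the difference of the norm of \<open>a\<close> and the norm of zero,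
      so one element witnesses the norm clause for both ideals.\<close>
    have "d = d'"
      using d d' ideal_carrier[OF I Y d(1)] ideal_carrier[OF J Y d'(1)] tmul_closed[OF X Y f X.zero_closed]
      by (metis Y.r_neg1)
    thus "tmul T X Y f a \<in> tmul T X Y f \<zero>\<^bsub>R X\<^esub> <+\<^bsub>R Y\<^esub> (I Y \<inter> J Y)"
      using d d' by (auto simp: a_l_coset_def')
  qed
qed

text \<open>One inclusion holds because induction preserves each ideal; coprimality at
  \<open>X\<close> enters through the splitting of 1 in the other.\<close>

lemma tambara_ideal_prod_coprime:
  assumes I: "tambara_ideal G T I" and J: "tambara_ideal G T J" and X: "finite_gset G X"
    and IJ: "I X <+>\<^bsub>R X\<^esub> J X = carrier (R X)"
  shows "tambara_ideal_prod G T I J X = I X \<inter> J X"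
proof (intro equalityI subsetI)
  fix x assume "x \<in> tambara_ideal_prod G T I J X"
  then obtain A p a b where A: "finite_gset G A" and p: "p \<in> ghom G A X" and a: "a \<in> I A" and b: "b \<in> J A"
    and x: "x = tadd T A X p (a \<otimes>\<^bsub>R A\<^esub> b)" unfolding tambara_ideal_prod_def by blast
  have "a \<otimes>\<^bsub>R A\<^esub> b \<in> I A" "a \<otimes>\<^bsub>R A\<^esub> b \<in> J A"
    using a b ideal.I_r_closed[OF ideal_ring[OF I A]] ideal.I_l_closed[OF ideal_ring[OF J A]]
      ideal_carrier[OF I A] ideal_carrier[OF J A] by blast+
  thus "x \<in> I X \<inter> J X"
    unfolding x using ideal_closed(2)[OF I A X p] ideal_closed(2)[OF J A X p] by blast
next
  fix x assume x: "x \<in> I X \<inter> J X"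
  interpret X: cring "R X" by (rule tring_cring[OF I X])
  have xc: "x \<in> carrier (R X)" using x ideal_carrier[OF I X] by blast
  obtain e f where ef: "e \<in> I X" "f \<in> J X" "\<one>\<^bsub>R X\<^esub> = e \<oplus>\<^bsub>R X\<^esub> f"
    by (rule X.comaximalE[OF IJ])
  note efc = ideal_carrier[OF I X ef(1)] ideal_carrier[OF J X ef(2)]
  obtain W i p where p: "fold_map 2 i G W X p" by (rule fold_map_exists[OF X])
  note W = fold_mapD[OF p]
  interpret W: cring "R W" by (rule tring_cring[OF I W(3)])
  \<comment> \<open>\<open>c\<close> is the pair (e, x) and \<open>d\<close> the pair (x, f): since
    \<open>x\<close> lies in both ideals, \<open>c\<close> has all components in \<open>I\<close>
    and \<open>d\<close> all components in \<open>J\<close>.\<close>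
  obtain c where c: "c \<in> carrier (R W)" "\<And>k. k < 2 \<Longrightarrow> tres T X W (i k) c = (if k = 0 then e else x)"
    by (rule tcoproduct_lift[OF W(1), of "\<lambda>k. if k = 0 then e else x"]) (use efc xc in auto)
  obtain d where d: "d \<in> carrier (R W)" "\<And>k. k < 2 \<Longrightarrow> tres T X W (i k) d = (if k = 0 then x else f)"
    by (rule tcoproduct_lift[OF W(1), of "\<lambda>k. if k = 0 then x else f"]) (use efc xc in auto)
  have cI: "c \<in> I W" by (rule ideal_coproduct[OF I W(1) c(1)]) (use c ef x in auto)
  have dJ: "d \<in> J W" by (rule ideal_coproduct[OF J W(1) d(1)]) (use d ef x in auto)
  have "tres T X W (i k) (c \<otimes>\<^bsub>R W\<^esub> d) = tres T X W (i k) c \<otimes>\<^bsub>R X\<^esub> tres T X W (i k) d" if "k < 2" for k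
    using tres_mult[OF X W(3) W(5)[OF that] c(1) d(1)] .
  from this[of 0] this[of 1] have "tadd T W X p (c \<otimes>\<^bsub>R W\<^esub> d) = e \<otimes>\<^bsub>R X\<^esub> x \<oplus>\<^bsub>R X\<^esub> x \<otimes>\<^bsub>R X\<^esub> f"
    using tadd_fold[OF p W.m_closed[OF c(1) d(1)]] by (simp add: c(2) d(2))
  also have "\<dots> = (e \<oplus>\<^bsub>R X\<^esub> f) \<otimes>\<^bsub>R X\<^esub> x"
    using efc xc by (simp add: X.l_distr X.m_comm[OF xc])
  also have "\<dots> = x" using ef(3) xc by (metis X.l_one)
  finally show "x \<in> tambara_ideal_prod G T I J X"
    using W cI dJ unfolding tambara_ideal_prod_def by blast
qed

lemma tambara_chinese_remainder:
  fixes I :: "nat \<Rightarrow> ('g, 'x) gset \<Rightarrow> 'r set"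
  assumes l: "l \<ge> 1" and I: "\<And>i. i \<in> {1..l} \<Longrightarrow> tambara_ideal G T (I i)"
    and coprime: "\<And>i j. \<lbrakk>1 \<le> i; i < j; j \<le> l\<rbrakk> \<Longrightarrow> coprime_ideals G T (I i) (I j)"
  defines "J \<equiv> iterated_prod (tambara_ideal_prod G T) I l"
  shows "\<And>X. finite_gset G X \<Longrightarrow> J X = iterated_prod (ideal_prod (R X)) (\<lambda>i. I i X) l"
    and "\<And>X. finite_gset G X \<Longrightarrow> J X = (\<Inter>i\<in>{1..l}. I i X)"
    and "tambara_iso G (tambara_quot G T J) (tambara_prod {1..l} (\<lambda>i. tambara_quot G T (I i)))
      (\<lambda>X C. \<lambda>i\<in>{1..l}. quot_proj G T (I i) X C)"
proof -
  have cop: "I i X <+>\<^bsub>R X\<^esub> I j X = carrier (R X)"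
    if "1 \<le> i" "i < j" "j \<le> l" "finite_gset G X" for i j X
    using coprime[OF that(1-3)] that(4) by (simp add: coprime_ideals_def ideal_sum_def carrier_tring)
  \<comment> \<open>A member of the family provides the ring structure; \<open>l \<ge> 1\<close>
    ensures that there is one.\<close>
  have ring: "cring (R X)" if "finite_gset G X" for X
    using tring_cring[OF I that] l by (metis atLeastAtMost_iff order_refl)
  have ide: "ideal (I i X) (R X)" if "i \<in> {1..l}" "finite_gset G X" for i X
    using ideal_ring[OF I] that by blast
  let ?P = "iterated_prod (tambara_ideal_prod G T) I"
  \<comment> \<open>Both kinds of product are compared with the intersection, and idealness of the
    partial product is carried along because the next multiplication requires it.\<close>
  have step: "tambara_ideal G T (?P m) \<and> (\<forall>X. finite_gset G X \<longrightarrow> ?P m X = (\<Inter>i\<in>{1..m}. I i X)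
      \<and> iterated_prod (ideal_prod (R X)) (\<lambda>i. I i X) m = (\<Inter>i\<in>{1..m}. I i X))"
    if "1 \<le> m" "m \<le> l" for m
    using that
  proof (induction m rule: nat_induct_at_least)
    case base
    thus ?case using I by (simp add: iterated_prod_1)
  next
    case (Suc m)
    hence IH: "tambara_ideal G T (?P m)" "\<And>X. finite_gset G X \<Longrightarrow> ?P m X = (\<Inter>i\<in>{1..m}. I i X)"
      "\<And>X. finite_gset G X \<Longrightarrow> iterated_prod (ideal_prod (R X)) (\<lambda>i. I i X) m = (\<Inter>i\<in>{1..m}. I i X)"
      by auto
    have Im: "tambara_ideal G T (I (Suc m))" using I Suc.prems by simp
    have cm: "(\<Inter>i\<in>{1..m}. I i X) <+>\<^bsub>R X\<^esub> I (Suc m) X = carrier (R X)"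
      and im: "ideal (\<Inter>i\<in>{1..m}. I i X) (R X)" if X: "finite_gset G X" for X
    proof -
      interpret X: cring "R X" by (rule ring[OF X])
      have "ideal (\<Inter>i\<in>{1..m}. I i X) (R X) \<and> (\<Inter>i\<in>{1..m}. I i X) <+>\<^bsub>R X\<^esub> I (Suc m) X = carrier (R X)"
        using Suc X by (intro X.coprime_Inter ide cop) auto
      thus "(\<Inter>i\<in>{1..m}. I i X) <+>\<^bsub>R X\<^esub> I (Suc m) X = carrier (R X)" "ideal (\<Inter>i\<in>{1..m}. I i X) (R X)"
        by auto
    qed
    have set: "(\<Inter>i\<in>{1..Suc m}. I i X) = (\<Inter>i\<in>{1..m}. I i X) \<inter> I (Suc m) X" for X
      by (auto simp: atLeastAtMostSuc_conv)
    have eq: "?P (Suc m) X = ?P m X \<inter> I (Suc m) X" if X: "finite_gset G X" for X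
      unfolding iterated_prod_Suc[OF Suc.hyps]
      by (rule tambara_ideal_prod_coprime[OF IH(1) Im X]) (simp only: IH(2)[OF X] cm[OF X])
    \<comment> \<open>The new product inherits this from the intersection, with which it agrees at
      finite G-sets.\<close>
    have "tambara_ideal G T (?P (Suc m))"
      using tambara_ideal_inter[OF IH(1) Im] tambara_ideal_cong[of G "?P (Suc m)" "\<lambda>X. ?P m X \<inter> I (Suc m) X", OF eq]
      by blast
    moreover have "iterated_prod (ideal_prod (R X)) (\<lambda>i. I i X) (Suc m) = (\<Inter>i\<in>{1..Suc m}. I i X)"
      if X: "finite_gset G X" for X
      unfolding iterated_prod_Suc[OF Suc.hyps] IH(3)[OF X] set
      by (rule cring.ideal_prod_eq_inter[OF ring[OF X] im[OF X] ideal_ring[OF Im X] cm[OF X]])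
    ultimately show ?case using eq IH(2) set by simp
  qed
  have J: "tambara_ideal G T J" and JX: "\<And>X. finite_gset G X \<Longrightarrow> J X = (\<Inter>i\<in>{1..l}. I i X)"
    and "\<And>X. finite_gset G X \<Longrightarrow> J X = iterated_prod (ideal_prod (R X)) (\<lambda>i. I i X) l"
    using step[OF l order_refl] by (simp_all add: J_def)
  thus "\<And>X. finite_gset G X \<Longrightarrow> J X = iterated_prod (ideal_prod (R X)) (\<lambda>i. I i X) l"
    and "\<And>X. finite_gset G X \<Longrightarrow> J X = (\<Inter>i\<in>{1..l}. I i X)" by auto

  let ?S = "tambara_prod {1..l} (\<lambda>i. tambara_quot G T (I i))"
  let ?\<phi> = "\<lambda>X C. \<lambda>i\<in>{1..l}. quot_proj G T (I i) X C"
  \<comment> \<open>The map to the product is studied on \<open>T\<close> itself, before passing to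
    the quotient by \<open>J\<close>: its surjectivity is the Chinese remainder theorem at each
    \<open>X\<close>.\<close>
  define \<theta> where "\<theta> = (\<lambda>X a. \<lambda>i\<in>{1..l}. I i X +>\<^bsub>R X\<^esub> a)"
  have \<theta>: "tambara_map G T ?S \<theta>"
    unfolding \<theta>_def by (rule tambara_prod_map[OF tambara_quot_map[OF I]])
  have \<theta>_surj: "tobj ?S X \<subseteq> \<theta> X ` tobj T X" if X: "finite_gset G X" for X
  proof
    fix y assume y: "y \<in> tobj ?S X"
    interpret X: cring "R X" by (rule ring[OF X])
    have "\<exists>a\<in>carrier (R X). y i = I i X +>\<^bsub>R X\<^esub> a" if "i \<in> {1..l}" for i
      using y that unfolding tambara_prod_def by (fastforce simp: tambara_quot_obj PiE_iff image_iff)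
    then obtain a where a: "\<And>i. i \<in> {1..l} \<Longrightarrow> a i \<in> carrier (R X) \<and> y i = I i X +>\<^bsub>R X\<^esub> a i"
      by metis
    have "I i X <+>\<^bsub>R X\<^esub> I j X = carrier (R X)" if "i \<in> {1..l}" "j \<in> {1..l}" "i \<noteq> j" for i j
      using cop[of i j X] cop[of j i X] X that
        X.set_add_comm[OF ideal_subset[OF I[OF that(1)] X] ideal_subset[OF I[OF that(2)] X]]
      by (cases "i < j") auto
    then obtain x where x: "x \<in> carrier (R X)" "\<forall>i\<in>{1..l}. I i X +>\<^bsub>R X\<^esub> x = I i X +>\<^bsub>R X\<^esub> a i"
      using X.chinese_remainder_solution[of "{1..l}" "\<lambda>i. I i X" a] l a ide[OF _ X] by auto
    have "y = \<theta> X x"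
      using y x a by (intro extensionalityI[of _ "{1..l}"]) (auto simp: \<theta>_def tambara_prod_def PiE_def)
    thus "y \<in> \<theta> X ` tobj T X" using x by (simp add: carrier_tring)
  qed
  have S: "tambara_functor G ?S"
    by (rule tambara_image[OF \<theta> \<theta>_surj tambara_prod_separated]) (simp_all add: tambara_quot_separated I)
  have \<phi>\<theta>: "?\<phi> X (J X +>\<^bsub>R X\<^esub> a) = \<theta> X a" if X: "finite_gset G X" and a: "a \<in> carrier (R X)" for X a
  proof -
    interpret J: ideal "J X" "R X" by (rule ideal_ring[OF J X])
    have "quot_proj G T (I i) X (J X +>\<^bsub>R X\<^esub> a) = I i X +>\<^bsub>R X\<^esub> a" if i: "i \<in> {1..l}" for i
    proof -
      interpret Ii: ideal "I i X" "R X" by (rule ide[OF i X])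
      have "I i X +>\<^bsub>R X\<^esub> b = I i X +>\<^bsub>R X\<^esub> a" if "b \<in> J X +>\<^bsub>R X\<^esub> a" for b
      proof -
        have "b \<in> I i X +>\<^bsub>R X\<^esub> a" using that JX[OF X] i by (auto simp: a_r_coset_def')
        thus ?thesis using Ii.a_repr_independence' a by blast
      qed
      thus ?thesis using J.a_rcos_self[OF a] unfolding quot_proj_def by blast
    qed
    thus ?thesis unfolding \<theta>_def by (rule restrict_ext)
  qed
  have \<phi>: "tambara_map G (tambara_quot G T J) ?S ?\<phi>"
    by (rule tambara_map_factor[OF tambara_quot_map[OF J] \<theta> _ _ tambara_functor_axioms])
      (simp_all only: tambara_quot_obj carrier_tring \<phi>\<theta>)
  have "bij_betw (?\<phi> X) (tobj (tambara_quot G T J) X) (tobj ?S X)" if X: "finite_gset G X" for X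
  proof -
    interpret X: cring "R X" by (rule ring[OF X])
    have "C = D" if CD: "C \<in> tobj (tambara_quot G T J) X" "D \<in> tobj (tambara_quot G T J) X" "?\<phi> X C = ?\<phi> X D" for C D
    proof -
      obtain a b where a: "a \<in> carrier (R X)" "C = J X +>\<^bsub>R X\<^esub> a" and b: "b \<in> carrier (R X)" "D = J X +>\<^bsub>R X\<^esub> b"
        using CD by (auto simp: tambara_quot_obj)
      have eq: "\<theta> X a = \<theta> X b" using CD(3) \<phi>\<theta>[OF X a(1)] \<phi>\<theta>[OF X b(1)] a b by simp
      have "I i X +>\<^bsub>R X\<^esub> a = I i X +>\<^bsub>R X\<^esub> b" if "i \<in> {1..l}" for i
        using fun_cong[OF eq, of i] that by (simp add: \<theta>_def)
      \<comment> \<open>Equal cosets modulo every \<open>I i\<close> put the difference into the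
        intersection, which is \<open>J X\<close> by the second claim.\<close>
      hence "a \<ominus>\<^bsub>R X\<^esub> b \<in> J X"
        unfolding JX[OF X] using X.quotient_eq_iff_same_a_r_cos[OF ide[OF _ X] a(1) b(1)] by blast
      thus "C = D" using X.quotient_eq_iff_same_a_r_cos[OF ideal_ring[OF J X] a(1) b(1)] a b by simp
    qed
    moreover have "?\<phi> X ` tobj (tambara_quot G T J) X = tobj ?S X"
    proof
      show "?\<phi> X ` tobj (tambara_quot G T J) X \<subseteq> tobj ?S X"
        using tambara_mapD(1)[OF \<phi> X] by blast
      show "tobj ?S X \<subseteq> ?\<phi> X ` tobj (tambara_quot G T J) X"
      proof
        fix y assume "y \<in> tobj ?S X"
        then obtain a where a: "a \<in> carrier (R X)" "y = \<theta> X a" using \<theta>_surj[OF X] by (auto simp: carrier_tring)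
        have "J X +>\<^bsub>R X\<^esub> a \<in> tobj (tambara_quot G T J) X"
          using a(1) by (simp add: tambara_quot_obj)
        thus "y \<in> ?\<phi> X ` tobj (tambara_quot G T J) X"
          unfolding a(2) \<phi>\<theta>[OF X a(1), symmetric] by (rule imageI)
      qed
    qed
    ultimately show ?thesis by (auto simp: bij_betw_def intro!: inj_onI)
  qed
  thus "tambara_iso G (tambara_quot G T J) ?S ?\<phi>"
    by (rule tambara_isoI[OF tambara_quot_functor[OF J] S \<phi>])
qed

end

theorem corollary3p19:
  fixes G :: "('g, 'c) monoid_scheme"
    and T :: "('g, 'x::infinite, 'r) tambara"
    and I :: "nat \<Rightarrow> ('g, 'x) gset \<Rightarrow> 'r set"
    and l :: nat
  assumes "group G" and "finite (carrier G)"
    and "tambara_functor G T"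
    and "l \<ge> 1"
    and "\<forall>i\<in>{1..l}. tambara_ideal G T (I i)"
    and "\<forall>i j. 1 \<le> i \<and> i < j \<and> j \<le> l \<longrightarrow> coprime_ideals G T (I i) (I j)"
  shows "(\<forall>X. finite_gset G X \<longrightarrow>
             iterated_prod (tambara_ideal_prod G T) I l X
               = iterated_prod (ideal_prod (tring G T X)) (\<lambda>i. I i X) l)
       \<and> (\<forall>X. finite_gset G X \<longrightarrow>
             iterated_prod (tambara_ideal_prod G T) I l X = (\<Inter>i\<in>{1..l}. I i X))
       \<and> tambara_iso G
             (tambara_quot G T (iterated_prod (tambara_ideal_prod G T) I l))
             (tambara_prod {1..l} (\<lambda>i. tambara_quot G T (I i)))
             (\<lambda>X C. \<lambda>i\<in>{1..l}. quot_proj G T (I i) X C)"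
proof -
  interpret tambara_functor G T by fact
  have I: "\<And>i. i \<in> {1..l} \<Longrightarrow> tambara_ideal G T (I i)"
    and coprime: "\<And>i j. \<lbrakk>1 \<le> i; i < j; j \<le> l\<rbrakk> \<Longrightarrow> coprime_ideals G T (I i) (I j)"
    using assms(5,6) by blast+
  show ?thesis
    using tambara_chinese_remainder[OF assms(4) I coprime] by (intro conjI allI impI)
qed

end
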